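(* Let $G=(V,E)$ be a finite, connected, acyclic, undirected, unweighted graph with $|V|\ge 2$. Then the algorithm LS-MV-Alg described in the context is a self-stabilizing in-network leader selection algorithm for the maximal-variance single-leader selection problem LS-MV: minimize $M(\{u\})$ over $u\in V$. Explicitly: for every choice of initial leader $\ell(0)\in V$, every choice of real initial values $h_i(0)$, $i\in V$, and every way of resolving ties in the leadership-transfer rule, the execution of LS-MV-Alg on $G$ has exactly one leader $\ell(t)\in V$ in every round $t$, and there exist a finite round $T_0$ and a node $u^*\in V$ with $M(\{u^*\})=\min_{u\in V}M(\{u\})$ such that $\ell(t)=u^*$ for all $t\ge T_0$.
   Context: **Leader-follower system.** $G=(V,E)$ is a connected undirected graph and $N(i)$ is the set of neighbors of node $i$. Each node $i$ has a scalar state $x_i(t)$. Given a nonempty leader set $U\subseteq V$, leaders keep a constant state $x_i(t)=\bar x$ for all $t\ge 0$, $i\in U$, where $\bar x\in\mathbb{R}$. Followers $i\in V\setminus U$ obey $\dot x_i(t)=-\sum_{j\in N(i)}(x_i(t)-x_j(t))+w_i(t)$, where the $w_i$ are independent zero-mean, unit-variance white noise processes. The steady-state variance of follower $i$ is $\sigma_i=\lim_{t\to\infty}\mathbf{E}[(x_i(t)-\bar x)^2]$. It is known that $\sigma_i=\tfrac12(L_{ff}^{-1})_{ii}$, where $L_{ff}$ is the principal submatrix, indexed by the followers, of the graph Laplacian (degree matrix minus adjacency matrix) of $G$; $L_{ff}$ is positive definite. **Performance measure.** The maximum steady-state variance is $M(U)=\max_{i\in V\setminus U}\sigma_i$. LS-MV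 is the problem of minimizing $M(U)$ subject to $U\subseteq V$, $|U|=1$. An optimal leader is a node $u$ minimizing $M(\{u\})$. **In-network leader selection.** Agents operate in synchronous rounds $t=0,1,2,\dots$, exchanging information only with neighbors. Initially exactly one arbitrary node is leader. In each round the current leader may hand leadership to one of its neighbors. An in-network leader selection algorithm is *self-stabilizing* if, starting with any initial leader (and any initial values of the algorithm's variables), the leadership role is transferred to an optimal leader in a finite number of steps (convergence) and remains there for all subsequent steps (closure). **Algorithm LS-MV-Alg.** Each agent $i$ holds a number $h_i(t)$ (with arbitrary initial value $h_i(0)$). In round $t$: 1. Every agent $i$ sends $h_i(t)$ to all its neighbors and sets $$h_i(t+1)=\begin{cases}0 & \text{if } |N(i)|=1,\\ 1+\max H_i^-(t) & \text{otherwise,}\end{cases}$$ where $H_i^-(t)$ is the multiset $\{h_j(t): j\in N(i)\}$ with one occurrence of its maximum removed, and $\max H_i^-(t)$ is its largest element. 2. Let $i=\ell(t)$ be the current leader. If $h_j(t)>h_i(t+1)$ for some $j\in N(i)$, then $\ell(t+1)=k$ for some $k\in\arg\max_{j\in N(i)}h_j(t)$ (ties broken arbitrarily). Otherwise $\ell(t+1)=i$. *)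

theory Defs
  imports "HOL-Probability.Probability" "Graph_Theory.Graph_Theory"
begin

section \<open>Trees\<close>

text \<open>
  A simple undirected graph is a finite symmetric loop-free digraph without parallel arcs
  (\<^locale>\<open>pair_graph\<close>): each undirected edge is represented by its two orientations.
\<close>

definition neighbors :: "'a pair_pre_digraph \<Rightarrow> 'a \<Rightarrow> 'a set" where
  "neighbors G i = {j. (i, j) \<in> parcs G}"

text \<open>
  The library's \<^const>\<open>forest\<close> is meant for directed graphs: in a symmetric digraph
  the two orientations of an edge already form a \<^const>\<open>pre_digraph.cycle\<close> of length 2.
  The cycles of the underlying undirected graph are those of length at least 3.
\<close>

definition undirected_acyclic :: "'a pair_pre_digraph \<Rightarrow> bool" where
  "undirected_acyclic G \<longleftrightarrow> \<not> (\<exists>p. pre_digraph.cycle (with_proj G) p \<and> 3 \<le> length p)"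

section \<open>Leader-follower systems driven by white noise\<close>

text \<open>
  Unit-variance Gaussian white noise is the formal derivative of a standard Wiener process.
  The argument is the process as a function of the time \<open>t \<ge> 0\<close> and the sample point;
  its values at negative times are irrelevant.
\<close>

definition wiener_process :: "'w measure \<Rightarrow> (real \<Rightarrow> 'w \<Rightarrow> real) \<Rightarrow> bool" where
  "wiener_process P B \<longleftrightarrow>
     (\<forall>t\<ge>0. B t \<in> borel_measurable P) \<and>
     (AE \<omega> in P. B 0 \<omega> = 0 \<and> continuous_on {0..} (\<lambda>t. B t \<omega>)) \<and>
     (\<forall>s t. 0 \<le> s \<and> s < t \<longrightarrow>
        distributed P lborel (\<lambda>\<omega>. B t \<omega> - B s \<omega>) (normal_density 0 (sqrt (t - s)))) \<and>
     (\<forall>(n::nat) \<tau>. 0 \<le> \<tau> 0 \<and> (\<forall>k<n. \<tau> k < \<tau> (Suc k)) \<longrightarrow>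
        prob_space.indep_vars P (\<lambda>_. borel) (\<lambda>k \<omega>. B (\<tau> (Suc k)) \<omega> - B (\<tau> k) \<omega>) {..<n})"

text \<open>
  Independence of the processes is independence of their whole paths, as random elements of
  the product space indexed by the half-line \<open>{0..}\<close>.
\<close>

definition independent_wiener_processes ::
    "'w measure \<Rightarrow> 'a set \<Rightarrow> ('a \<Rightarrow> real \<Rightarrow> 'w \<Rightarrow> real) \<Rightarrow> bool" where
  "independent_wiener_processes P I W \<longleftrightarrow>
     (\<forall>i\<in>I. wiener_process P (W i)) \<and>
     prob_space.indep_vars P (\<lambda>_. Pi\<^sub>M {0..} (\<lambda>_. borel)) (\<lambda>i \<omega>. \<lambda>t\<in>{0..}. W i t \<omega>) I"

text \<open>
  \<open>x i t \<omega>\<close> is the state of node \<open>i\<close>. The equation \<open>\<dot>x_i = - \<Sum> (x_i - x_j) + w_i\<close>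
  is read as a stochastic differential equation with additive noise, that is, as the integral
  equation obtained from it by integrating over \<open>{0..t}\<close>; the integral of the
  noise is the Wiener process \<open>W i\<close>, so no stochastic integral is involved.
  The initial follower states are arbitrary (deterministic or random) with finite second moment.
\<close>

locale leader_follower_system = prob_space P
  for G :: "'a pair_pre_digraph"
    and U :: "'a set"
    and xbar :: real
    and P :: "'w measure"
    and W :: "'a \<Rightarrow> real \<Rightarrow> 'w \<Rightarrow> real"
    and x :: "'a \<Rightarrow> real \<Rightarrow> 'w \<Rightarrow> real" +
  assumes noise: "independent_wiener_processes P (pverts G - U) W"
    and state_measurable: "\<And>i t. i \<in> pverts G \<Longrightarrow> 0 \<le> t \<Longrightarrow> x i t \<in> borel_measurable P"
    and initial_state: "\<And>i. i \<in> pverts G - U \<Longrightarrow> integrable P (\<lambda>\<omega>. (x i 0 \<omega>)\<^sup>2)"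
    and leader_state: "\<And>i t \<omega>. i \<in> U \<Longrightarrow> 0 \<le> t \<Longrightarrow> \<omega> \<in> space P \<Longrightarrow> x i t \<omega> = xbar"
    and follower_continuous:
      "\<And>i. i \<in> pverts G - U \<Longrightarrow> AE \<omega> in P. continuous_on {0..} (\<lambda>t. x i t \<omega>)"
    and follower_dynamics:
      "\<And>i. i \<in> pverts G - U \<Longrightarrow> AE \<omega> in P. \<forall>t\<ge>0.
         x i t \<omega> = x i 0 \<omega>
           + integral {0..t} (\<lambda>s. - (\<Sum>j\<in>neighbors G i. x i s \<omega> - x j s \<omega>)) + W i t \<omega>"

definition steady_state_variance ::
    "real \<Rightarrow> 'w measure \<Rightarrow> ('a \<Rightarrow> real \<Rightarrow> 'w \<Rightarrow> real) \<Rightarrow> 'a \<Rightarrow> real" where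
  "steady_state_variance xbar P x i = Lim at_top (\<lambda>t::real. \<integral>\<omega>. (x i t \<omega> - xbar)\<^sup>2 \<partial>P)"

definition max_steady_state_variance ::
    "'a pair_pre_digraph \<Rightarrow> 'a set \<Rightarrow> real \<Rightarrow> 'w measure \<Rightarrow> ('a \<Rightarrow> real \<Rightarrow> 'w \<Rightarrow> real) \<Rightarrow> real"
  where
  "max_steady_state_variance G U xbar P x = (MAX i\<in>pverts G - U. steady_state_variance xbar P x i)"

section \<open>Leader selection\<close>

text \<open>\<open>M\<close> is the performance measure, as a function of the leader set.\<close>

definition optimal_leader :: "'a pair_pre_digraph \<Rightarrow> ('a set \<Rightarrow> real) \<Rightarrow> 'a \<Rightarrow> bool" where
  "optimal_leader G M u \<longleftrightarrow> is_arg_min (\<lambda>v. M {v}) (\<lambda>v. v \<in> pverts G) u"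

text \<open>
  \<open>run v0 l0 l\<close> states that \<open>l\<close> is the sequence of leaders in some execution of the
  algorithm with initial variables \<open>v0\<close> and initial leader \<open>l0\<close>; a nondeterministic algorithm
  has several such sequences. Existence of a run means that the algorithm never gets stuck.
\<close>

definition self_stabilizing_leader_selection ::
    "'a pair_pre_digraph \<Rightarrow> ('a \<Rightarrow> bool) \<Rightarrow> ('v \<Rightarrow> 'a \<Rightarrow> (nat \<Rightarrow> 'a) \<Rightarrow> bool) \<Rightarrow> bool" where
  "self_stabilizing_leader_selection G optimal run \<longleftrightarrow>
     (\<forall>v0. \<forall>l0\<in>pverts G.
        (\<exists>l. run v0 l0 l) \<and>
        (\<forall>l. run v0 l0 l \<longrightarrow>
           (\<forall>t. l t \<in> pverts G) \<and>
           (\<forall>t. l (Suc t) = l t \<or> l (Suc t) \<in> neighbors G (l t)) \<and>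
           (\<exists>T0 u. optimal u \<and> (\<forall>t\<ge>T0. l t = u))))"

definition max_H_minus :: "'a pair_pre_digraph \<Rightarrow> ('a \<Rightarrow> real) \<Rightarrow> 'a \<Rightarrow> real" where
  "max_H_minus G h i =
     (let H = image_mset h (mset_set (neighbors G i)) in Max_mset (H - {#Max_mset H#}))"

primrec ls_mv_value :: "'a pair_pre_digraph \<Rightarrow> ('a \<Rightarrow> real) \<Rightarrow> nat \<Rightarrow> 'a \<Rightarrow> real" where
  "ls_mv_value G h0 0 = h0"
| "ls_mv_value G h0 (Suc t) =
     (\<lambda>i. if card (neighbors G i) = 1 then 0 else 1 + max_H_minus G (ls_mv_value G h0 t) i)"

definition ls_mv_run :: "'a pair_pre_digraph \<Rightarrow> ('a \<Rightarrow> real) \<Rightarrow> 'a \<Rightarrow> (nat \<Rightarrow> 'a) \<Rightarrow> bool" where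
  "ls_mv_run G h0 l0 l \<longleftrightarrow>
     l 0 = l0 \<and>
     (\<forall>t. if \<exists>j\<in>neighbors G (l t). ls_mv_value G h0 t j > ls_mv_value G h0 (Suc t) (l t)
          then is_arg_max (ls_mv_value G h0 t) (\<lambda>j. j \<in> neighbors G (l t)) (l (Suc t))
          else l (Suc t) = l t)"

end

theory Submission
  imports Defs "HOL-Real_Asymp.Real_Asymp"
begin

text \<open>
  On a tree the column \<open>i\<close> of the inverse of the Laplacian grounded at the leader \<open>u\<close> is
  \<open>j \<mapsto> (d(u,i) + d(u,j) - d(i,j)) / 2\<close>, so the steady-state variance of \<open>i\<close> is \<open>d(u,i) / 2\<close> and
  \<open>M({u})\<close> is half the eccentricity of \<open>u\<close>: the optimal leaders are the centers of the tree. The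
  variance is computed by duality: the state paired with a solution of the backward heat equation
  is a Wiener integral, whose second moment is the energy integral of that solution.

  Root the tree at a center \<open>c\<close>. The node variables reach the height of each node (at \<open>c\<close>: one
  plus the second largest height of a neighbor) after finitely many rounds, since every value below
  is pushed up by one per round, and values above are corrected from the leaves upwards. From then
  on the leader moves strictly towards \<open>c\<close>, until it rests at \<open>c\<close> or at a neighbor of \<open>c\<close> of equal
  value, which is the second center.
\<close>

section \<open>Distances in a tree\<close>

text \<open>Deleting one maximum replaces knowledge of the parent. At a node other than
  \<open>c\<close> with several neighbors, exactly one neighbor is not a child, so after the
  deletion the new value is still at most one plus the value of some child, whatever the other
  values are; in the limit the deleted value is that of the parent. At \<open>c\<close> all
  neighbors are children, and the deletion hits the highest branch. Minimal eccentricity keeps the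
  two highest branches within one of each other, so no neighbor outbids \<open>c\<close>.

  For the variance, let q be column i of the inverse of the grounded Laplacian L, psi the heat flow
  started at q, and phi = L psi the flow started at the unit vector of i. Then <phi, psi> has
  derivative -2 |phi|^2 and tends to 0, so the energy integral of phi is q(i) / 2 = d(u,i) / 2,
  without diagonalizing L. The obstacle is that the sums of phi against the noise converge only
  pathwise; comparing dyadic grids makes them Cauchy in L2, and this carries their second moments to
  the limit.\<close>

definition hops :: "'a pair_pre_digraph \<Rightarrow> 'a \<Rightarrow> 'a \<Rightarrow> nat" where
  "hops G i j = (LEAST n. (i, j) \<in> parcs G ^^ n)"

locale tree_graph = pair_graph G for G :: "'a pair_pre_digraph" +
  assumes connected: "connected (with_proj G)"
    and acyclic: "undirected_acyclic G"
begin

abbreviation N :: "'a \<Rightarrow> 'a set" where "N \<equiv> neighbors G"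
abbreviation d :: "'a \<Rightarrow> 'a \<Rightarrow> nat" where "d \<equiv> hops G"

lemma neighbor_sym: "j \<in> N i \<longleftrightarrow> i \<in> N j"
  by (auto simp: neighbors_def intro: arcs_symmetric)

lemma neighbor_in_verts: "j \<in> N i \<Longrightarrow> j \<in> pverts G"
  by (auto simp: neighbors_def dest: in_arcsD2)

lemma neighbor_neq: "j \<in> N i \<Longrightarrow> j \<noteq> i"
  using pair_no_loops[of "(i, j)"] by (auto simp: neighbors_def)

lemma finite_neighbors: "finite (N i)"
  by (rule finite_subset[OF _ pair_finite_verts]) (auto dest: neighbor_in_verts)

text \<open>Connectedness makes the \<open>LEAST\<close> in \<open>hops\<close> range over a
  nonempty set; otherwise its value would be unspecified. \<open>connected\<close> means strong
  connectivity of the symmetric closure, and a symmetric graph is its own symmetric closure.\<close>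

lemma relpow_hops:
  assumes "i \<in> pverts G" "j \<in> pverts G"
  shows "(i, j) \<in> parcs G ^^ d i j"
proof -
  have "parcs (mk_symmetric (with_proj G)) = parcs G"
    using arcs_symmetric by (auto simp: mk_symmetric_def)
  moreover have "i \<rightarrow>\<^sup>*\<^bsub>with_proj (mk_symmetric (with_proj G))\<^esub> j"
    using connected assms unfolding connected_def strongly_connected_def
    by (simp add: mk_symmetric_def)
  ultimately have "(i, j) \<in> (parcs G)\<^sup>*"
    using reachable_rtranclI[of "with_proj (mk_symmetric (with_proj G))" i j] by simp
  then obtain n where "(i, j) \<in> parcs G ^^ n"
    by (auto simp: rtrancl_power)
  then show ?thesis
    unfolding hops_def by (rule LeastI)
qed

lemma hops_le: "(i, j) \<in> parcs G ^^ n \<Longrightarrow> d i j \<le> n"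
  unfolding hops_def by (rule Least_le)

lemma hops_self [simp]: "d i i = 0"
  using hops_le[of i i 0] by simp

lemma hops_eq_0D: "i \<in> pverts G \<Longrightarrow> j \<in> pverts G \<Longrightarrow> d i j = 0 \<Longrightarrow> i = j"
  using relpow_hops[of i j] by simp

lemma relpow_sym: "(i, j) \<in> parcs G ^^ n \<Longrightarrow> (j, i) \<in> parcs G ^^ n"
proof (induction n arbitrary: j)
  case (Suc n)
  then obtain k where "(i, k) \<in> parcs G ^^ n" "(k, j) \<in> parcs G" by auto
  then have "(j, k) \<in> parcs G" "(k, i) \<in> parcs G ^^ n"
    using Suc.IH arcs_symmetric by auto
  then show ?case by (rule relpow_Suc_I2)
qed auto

lemma hops_sym: "d i j = d j i"
  unfolding hops_def by (metis relpow_sym)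

lemma hops_triangle:
  assumes "i \<in> pverts G" "j \<in> pverts G" "k \<in> pverts G"
  shows "d i k \<le> d i j + d j k"
proof (rule hops_le)
  show "(i, k) \<in> parcs G ^^ (d i j + d j k)"
    using relpow_hops[of i j] relpow_hops[of j k] assms by (auto simp: relpow_add)
qed

lemma hops_neighbor:
  assumes "j \<in> N i"
  shows "d i j = 1"
proof -
  have "d i j \<le> 1"
    by (rule hops_le) (use assms in \<open>auto simp: neighbors_def\<close>)
  moreover have "d i j \<noteq> 0"
    using hops_eq_0D[of i j] assms neighbor_neq neighbor_in_verts neighbor_sym by metis
  ultimately show ?thesis by simp
qed

lemma hops_neighbor_le:
  assumes "r \<in> pverts G" "k \<in> N j"
  shows "d r k \<le> Suc (d r j)" "d r j \<le> Suc (d r k)"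
proof -
  have "j \<in> pverts G" "k \<in> pverts G" "d j k = 1" "d k j = 1"
    using assms neighbor_in_verts neighbor_sym hops_neighbor by auto
  then show "d r k \<le> Suc (d r j)" "d r j \<le> Suc (d r k)"
    using hops_triangle[of r j k] hops_triangle[of r k j] assms by auto
qed

lemma ex_closer_neighbor:
  assumes "r \<in> pverts G" "j \<in> pverts G" "j \<noteq> r"
  shows "\<exists>k \<in> N j. Suc (d r k) = d r j"
proof -
  obtain n where n: "d r j = Suc n"
    using hops_eq_0D[OF assms(1,2)] assms(3) by (cases "d r j") auto
  obtain k where k: "(r, k) \<in> parcs G ^^ n" "(k, j) \<in> parcs G"
    using relpow_hops[OF assms(1,2)] n by auto
  have "k \<in> N j" using k(2) arcs_symmetric by (auto simp: neighbors_def)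
  moreover have "d r k \<le> n" using k(1) by (rule hops_le)
  ultimately show ?thesis
    using n hops_neighbor_le(2)[OF assms(1), of k j] by force
qed

text \<open>Stepping to a closer neighbor each time controls every vertex visited, which is what
  allows such a walk to be kept away from a given vertex.\<close>

lemma walk_to_root:
  assumes "r \<in> pverts G" "k \<in> pverts G"
  shows "\<exists>p. awalk k p r \<and> (\<forall>v \<in> set (pawalk_verts k p). v = k \<or> d r v < d r k)"
  using assms(2)
proof (induction "d r k" arbitrary: k)
  case 0
  then have "k = r" using hops_eq_0D assms(1) by metis
  then have "awalk k [] r" using assms(1) by (simp add: awalk_Nil_iff)
  then show ?case by (intro exI[of _ "[]"]) auto
next
  case (Suc n)
  then have "k \<noteq> r" by auto
  then obtain m where m: "m \<in> N k" "Suc (d r m) = d r k"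
    using ex_closer_neighbor assms(1) Suc.prems by blast
  then have mV: "m \<in> pverts G" using neighbor_in_verts by auto
  obtain p where p: "awalk m p r" "\<forall>v \<in> set (pawalk_verts m p). v = m \<or> d r v < d r m"
    using Suc.hyps(1)[of m] Suc.hyps(2) m mV by auto
  have "awalk k ((k, m) # p) r"
    using p(1) m(1) by (auto simp: awalk_Cons_iff neighbors_def)
  then show ?case
    using p(2) m(2) by (intro exI[of _ "(k, m) # p"]) force
qed

lemma pawalk_rev:
  assumes "awalk u p v"
  shows "\<exists>q. awalk v q u \<and> set (pawalk_verts v q) = set (pawalk_verts u p)"
  using awalk_rev_path[of u p v] assms awalk_verts_rev_path[OF assms]
  by (intro exI[of _ "rev_path p"]) auto

text \<open>
  Two shortest walks from distinct such neighbors to \<open>r\<close> both avoid \<open>j\<close>, so together with \<open>j\<close>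
  they contain a cycle through \<open>j\<close>.
\<close>

lemma closer_neighbor_unique:
  assumes "r \<in> pverts G" "k \<in> N j" "k' \<in> N j" "d r k \<le> d r j" "d r k' \<le> d r j"
  shows "k = k'"
proof (rule ccontr)
  assume neq: "k \<noteq> k'"
  have V: "j \<in> pverts G" "k \<in> pverts G" "k' \<in> pverts G"
    using assms neighbor_in_verts neighbor_sym by auto
  have jk: "k \<noteq> j" "k' \<noteq> j" using assms neighbor_neq by auto
  obtain p where p: "awalk k p r" "\<forall>v \<in> set (pawalk_verts k p). v = k \<or> d r v < d r k"
    using walk_to_root assms V by blast
  obtain p' where p': "awalk k' p' r" "\<forall>v \<in> set (pawalk_verts k' p'). v = k' \<or> d r v < d r k'"
    using walk_to_root assms V by blast
  obtain q where q: "awalk r q k'" "set (pawalk_verts r q) = set (pawalk_verts k' p')"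
    using pawalk_rev[OF p'(1)] by auto
  have pq: "awalk k (p @ q) k'" using p(1) q(1) by auto
  \<comment> \<open>A vertex on either walk is its start, a neighbor of \<open>j\<close>, or is
    strictly closer to \<open>r\<close> than that neighbor and hence than \<open>j\<close>.\<close>
  have j_pq: "e \<in> set (p @ q) \<Longrightarrow> fst e \<noteq> j \<and> snd e \<noteq> j" for e
    using p(2) p'(2) q(2) assms(4,5) jk awalk_verts_arc1 awalk_verts_arc2 p(1) q(1)
    by (metis UnE leD set_append)
  \<comment> \<open>Shortcutting only drops arcs, so \<open>j\<close> stays avoided;
    \<open>k\<close> and \<open>k'\<close> differ, so at least one arc survives and the closed walk
    through \<open>j\<close> has length at least 3.\<close>
  define c where "c = awalk_to_apath (p @ q)"
  have c: "apath k c k'" unfolding c_def by (rule apath_awalk_to_apath[OF pq])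
  have "set c \<subseteq> set (p @ q)" unfolding c_def by (rule awalk_to_apath_subset[OF pq])
  then have j_c: "j \<notin> set (pawalk_verts k c)"
    using j_pq set_awalk_verts[of k c k'] c jk by (auto simp: apath_def)
  have "c \<noteq> []" using c neq by (auto simp: apath_Nil_iff)
  define z where "z = (j, k) # c @ [(k', j)]"
  have z: "awalk j z j"
    using c assms(2,3) V arcs_symmetric[of j k'] unfolding z_def
    by (auto simp: awalk_Cons_iff neighbors_def apath_def awalk_Nil_iff intro!: awalk_appendI)
  have "pawalk_verts j z = j # pawalk_verts k c @ [j]"
  proof -
    have "pawalk_verts k (c @ [(k', j)]) = pawalk_verts k c @ [j]"
      using c \<open>c \<noteq> []\<close>
      using awalk_verts_append[of k c "[(k', j)]" j] z
      by (auto simp: z_def apath_def awalk_Cons_iff)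
    then show ?thesis by (simp add: z_def)
  qed
  then have "distinct (tl (pawalk_verts j z))"
    using c j_c by (auto simp: apath_def)
  then have "cycle z" using z by (auto simp: cycle_def z_def)
  moreover have "3 \<le> length z" using \<open>c \<noteq> []\<close> by (cases c) (auto simp: z_def)
  ultimately show False using acyclic by (auto simp: undirected_acyclic_def)
qed

end

section \<open>The leader selection algorithm\<close>

lemma max_H_minus_eq:
  assumes "finite (neighbors G i)" "card (neighbors G i) \<ge> 2"
  shows "\<exists>m\<in>neighbors G i. (\<forall>j\<in>neighbors G i. h j \<le> h m)
           \<and> max_H_minus G h i = Max (h ` (neighbors G i - {m}))"
proof -
  let ?N = "neighbors G i"
  have ne: "?N \<noteq> {}" using assms by auto
  have "Max (h ` ?N) \<in> h ` ?N" using assms ne by (intro Max_in) auto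
  then obtain m where m: "m \<in> ?N" "h m = Max (h ` ?N)" by auto
  have "image_mset h (mset_set ?N) = add_mset (h m) (image_mset h (mset_set (?N - {m})))"
    using m assms(1) by (subst mset_set.remove[of _ m]) auto
  moreover have "Max_mset (image_mset h (mset_set ?N)) = h m"
    using m(2) assms(1) by simp
  ultimately have "max_H_minus G h i = Max (h ` (?N - {m}))"
    using assms(1) by (simp add: max_H_minus_def Let_def del: set_image_mset) simp
  moreover have "\<forall>j\<in>?N. h j \<le> h m" using m assms(1) by auto
  ultimately show ?thesis using m(1) by metis
qed

text \<open>Only one occurrence is deleted, so one of two large neighbors survives. The criterion
  does not mention the deleted element, so later arguments need no case distinction on ties.\<close>

lemma max_H_minus_ge_iff:
  assumes "finite (neighbors G i)" "card (neighbors G i) \<ge> 2"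
  shows "a \<le> max_H_minus G h i \<longleftrightarrow>
           (\<exists>j\<in>neighbors G i. \<exists>k\<in>neighbors G i. j \<noteq> k \<and> a \<le> h j \<and> a \<le> h k)"
proof -
  obtain m where m: "m \<in> neighbors G i" "\<forall>j\<in>neighbors G i. h j \<le> h m"
    and eq: "max_H_minus G h i = Max (h ` (neighbors G i - {m}))"
    using max_H_minus_eq[OF assms] by blast
  have "card (neighbors G i - {m}) \<ge> 1" using assms m(1) by simp
  then have "neighbors G i - {m} \<noteq> {}" by (metis card.empty not_one_le_zero)
  then have "a \<le> max_H_minus G h i \<longleftrightarrow> (\<exists>j\<in>neighbors G i - {m}. a \<le> h j)"
    unfolding eq using assms(1) by (subst Max_ge_iff) auto
  also have "\<dots> \<longleftrightarrow> (\<exists>j\<in>neighbors G i. \<exists>k\<in>neighbors G i. j \<noteq> k \<and> a \<le> h j \<and> a \<le> h k)"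
    (is "?l \<longleftrightarrow> ?r")
  proof
    assume ?l
    then obtain j where "j \<in> neighbors G i" "j \<noteq> m" "a \<le> h j" by auto
    then show ?r using m by (intro bexI[of _ j] bexI[of _ m]) auto
  next
    assume ?r
    then obtain j k where "j \<in> neighbors G i" "k \<in> neighbors G i" "j \<noteq> k" "a \<le> h j" "a \<le> h k"
      by auto
    then show ?l by (cases "j = m") auto
  qed
  finally show ?thesis .
qed

lemma max_H_minus_mono:
  assumes "finite (neighbors G i)" "card (neighbors G i) \<ge> 2"
    and "\<And>j. j \<in> neighbors G i \<Longrightarrow> h j \<le> h' j"
  shows "max_H_minus G h i \<le> max_H_minus G h' i"
proof -
  obtain j k where "j \<in> neighbors G i" "k \<in> neighbors G i" "j \<noteq> k"
    "max_H_minus G h i \<le> h j" "max_H_minus G h i \<le> h k"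
    using max_H_minus_ge_iff[OF assms(1,2), of "max_H_minus G h i" h] by auto
  then show ?thesis
    using assms(3)[of j] assms(3)[of k]
    by (subst max_H_minus_ge_iff[OF assms(1,2)]) (intro bexI[of _ j] bexI[of _ k], auto)
qed

section \<open>Rooted trees in metric terms: descendants, heights, parents\<close>

context tree_graph begin

definition ecc :: "'a \<Rightarrow> nat" where "ecc r = Max (d r ` pverts G)"

text \<open>The nodes below \<open>i\<close> in the tree rooted at \<open>c\<close>, encoded as
  "\<open>i\<close> lies on a geodesic from \<open>c\<close> to \<open>j\<close>". No orientation or
  parent map has to be chosen.\<close>

definition desc :: "'a \<Rightarrow> 'a \<Rightarrow> 'a set" where
  "desc c i = {j \<in> pverts G. d c j = d c i + d i j}"

definition height :: "'a \<Rightarrow> 'a \<Rightarrow> nat" where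
  "height c i = Max (d i ` desc c i)"

lemma hops_le_ecc: "j \<in> pverts G \<Longrightarrow> d r j \<le> ecc r"
  unfolding ecc_def using pair_finite_verts by auto

lemma ecc_leI:
  assumes "r \<in> pverts G" "\<And>j. j \<in> pverts G \<Longrightarrow> d r j \<le> n"
  shows "ecc r \<le> n"
  unfolding ecc_def using pair_finite_verts assms by (intro Max.boundedI) auto

lemma finite_desc: "finite (desc c i)"
  unfolding desc_def using pair_finite_verts by auto

lemma self_in_desc: "i \<in> pverts G \<Longrightarrow> i \<in> desc c i"
  by (simp add: desc_def)

lemma hops_le_height: "j \<in> desc c i \<Longrightarrow> d i j \<le> height c i"
  unfolding height_def using finite_desc by auto

lemma height_attained:
  assumes "i \<in> pverts G" obtains j where "j \<in> desc c i" "d i j = height c i"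
proof -
  have "height c i \<in> d i ` desc c i"
    unfolding height_def using finite_desc self_in_desc[OF assms] by (intro Max_in) auto
  then show ?thesis using that by auto
qed

lemma height_child:
  assumes "c \<in> pverts G" "k \<in> N i" "d c k = Suc (d c i)"
  shows "Suc (height c k) \<le> height c i"
proof -
  have V: "i \<in> pverts G" "k \<in> pverts G" using assms neighbor_in_verts neighbor_sym by auto
  obtain j where j: "j \<in> desc c k" "d k j = height c k" using height_attained V by blast
  have jV: "j \<in> pverts G" using j by (simp add: desc_def)
  have "d i j \<le> Suc (d k j)"
    using hops_neighbor_le(2)[OF jV assms(2)] by (simp add: hops_sym)
  moreover have "d c j \<le> d c i + d i j" using hops_triangle assms V jV by auto
  ultimately have "j \<in> desc c i" "d i j = Suc (d k j)"
    using j(1) assms(3) by (auto simp: desc_def)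
  then show ?thesis using hops_le_height[of j c i] j(2) by simp
qed

text \<open>The child is the next node on the way from \<open>i\<close> to \<open>j\<close>. Since
  \<open>i\<close> is on a geodesic from \<open>c\<close> to \<open>j\<close>, a step closer to
  \<open>j\<close> must be a step away from \<open>c\<close>.\<close>

lemma desc_child:
  assumes "c \<in> pverts G" "i \<in> pverts G" "j \<in> desc c i" "j \<noteq> i"
  obtains k where "k \<in> N i" "d c k = Suc (d c i)" "j \<in> desc c k" "d i j = Suc (d k j)"
proof -
  have jV: "j \<in> pverts G" using assms by (simp add: desc_def)
  obtain k where k: "k \<in> N i" "Suc (d j k) = d j i"
    using ex_closer_neighbor[OF jV assms(2)] assms(4) by auto
  have kV: "k \<in> pverts G" using k neighbor_in_verts by auto
  have "d c j \<le> d c k + d k j" using hops_triangle assms(1) kV jV by auto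
  moreover have "d c k \<le> Suc (d c i)" using hops_neighbor_le(1) assms(1) k(1) by auto
  ultimately have "d c k = Suc (d c i)" "j \<in> desc c k"
    using k(2) assms(3) by (auto simp: desc_def hops_sym)
  then show ?thesis using that k by (simp add: hops_sym[of _ j])
qed

lemma height_pos_child:
  assumes "c \<in> pverts G" "i \<in> pverts G" "height c i > 0"
  obtains k where "k \<in> N i" "d c k = Suc (d c i)" "height c i = Suc (height c k)"
proof -
  obtain j where j: "j \<in> desc c i" "d i j = height c i" using height_attained assms(2) by blast
  then have "j \<noteq> i" using assms(3) by auto
  then obtain k where k: "k \<in> N i" "d c k = Suc (d c i)" "j \<in> desc c k" "d i j = Suc (d k j)"
    using desc_child assms(1,2) j(1) by blast
  moreover have "height c i = Suc (height c k)"
    using hops_le_height[OF k(3)] k(4) j(2) height_child[OF assms(1) k(1,2)] by linarith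
  ultimately show ?thesis using that by blast
qed

text \<open>Acyclicity in rooted form: a second neighbor that is not farther from \<open>c\<close>,
  even one at equal distance, would contradict \<open>closer_neighbor_unique\<close>.\<close>

lemma ex_parent:
  assumes "c \<in> pverts G" "i \<in> pverts G" "i \<noteq> c"
  obtains p where "p \<in> N i" "Suc (d c p) = d c i"
    "\<And>k. k \<in> N i \<Longrightarrow> k \<noteq> p \<Longrightarrow> d c k = Suc (d c i)"
proof -
  obtain p where p: "p \<in> N i" "Suc (d c p) = d c i" using ex_closer_neighbor assms by blast
  have "d c k = Suc (d c i)" if "k \<in> N i" "k \<noteq> p" for k
    using closer_neighbor_unique[OF assms(1) that(1) p(1)] that p(2)
      hops_neighbor_le(1)[OF assms(1) that(1)] by linarith
  then show ?thesis using that p by blast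
qed

lemma root_neighbor: "k \<in> N c \<Longrightarrow> d c k = Suc (d c c)"
  using hops_neighbor by simp

lemma ecc_eq_height: "ecc c = height c c"
  unfolding ecc_def height_def desc_def by simp

lemma root_branch:
  assumes "c \<in> pverts G" "j \<in> pverts G" "j \<noteq> c"
  obtains k where "k \<in> N c" "j \<in> desc c k"
proof -
  have "j \<in> desc c c" using assms by (simp add: desc_def)
  then show ?thesis using desc_child[OF assms(1,1) _ assms(3)] that by metis
qed

end

section \<open>One round of the node variables as a monotone operator\<close>

locale nontrivial_tree = tree_graph +
  assumes two_verts: "2 \<le> card (pverts G)"
begin

lemma ex_other: obtains r where "r \<in> pverts G" "r \<noteq> i"
proof -
  have "\<not> card (pverts G) \<le> Suc 0" using two_verts by simp
  then show ?thesis using that card_le_Suc0_iff_eq[OF pair_finite_verts] by metis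
qed

lemma neighbors_nonempty:
  assumes "i \<in> pverts G" shows "N i \<noteq> {}"
  using ex_other[of i] ex_closer_neighbor[of _ i] assms by (metis empty_iff)

lemma card_neighbors: "i \<in> pverts G \<Longrightarrow> card (N i) = 1 \<or> 2 \<le> card (N i)"
  using neighbors_nonempty[of i] card_gt_0_iff[of "N i"] finite_neighbors[of i] by linarith

lemma two_neighbors:
  assumes "j \<in> N i" "k \<in> N i" "j \<noteq> k" shows "2 \<le> card (N i)"
  using card_mono[OF finite_neighbors, of "{j, k}" i] assms by auto

definition step :: "('a \<Rightarrow> real) \<Rightarrow> 'a \<Rightarrow> real" where
  "step h i = (if card (N i) = 1 then 0 else 1 + max_H_minus G h i)"

lemma ls_mv_value_step: "ls_mv_value G h0 (Suc t) i = step (ls_mv_value G h0 t) i"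
  by (simp add: step_def)

declare ls_mv_value.simps(2) [simp del]

text \<open>
  For a center \<open>c\<close> this is the fixed point to which the node variables converge: the height in the
  tree rooted at \<open>c\<close>, except at \<open>c\<close> itself, where the second highest branch counts.
\<close>

definition limit_value :: "'a \<Rightarrow> 'a \<Rightarrow> real" where
  "limit_value c i = (if i = c then step (\<lambda>k. real (height c k)) c else real (height c i))"

lemma step_ge_iff:
  assumes "i \<in> pverts G"
  shows "a \<le> step h i \<longleftrightarrow>
    (if card (N i) = 1 then a \<le> 0
     else \<exists>j\<in>N i. \<exists>k\<in>N i. j \<noteq> k \<and> a \<le> 1 + h j \<and> a \<le> 1 + h k)"
proof (cases "card (N i) = 1")
  case False
  have "a \<le> step h i \<longleftrightarrow> a - 1 \<le> max_H_minus G h i" using False by (auto simp: step_def)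
  also have "\<dots> \<longleftrightarrow> (\<exists>j\<in>N i. \<exists>k\<in>N i. j \<noteq> k \<and> a - 1 \<le> h j \<and> a - 1 \<le> h k)"
    using card_neighbors[OF assms] False by (intro max_H_minus_ge_iff finite_neighbors) auto
  finally show ?thesis using False by (simp add: algebra_simps)
qed (simp add: step_def)

lemma step_mono:
  assumes "i \<in> pverts G" "\<And>j. j \<in> N i \<Longrightarrow> h j \<le> h' j"
  shows "step h i \<le> step h' i"
proof (cases "card (N i) = 1")
  case False
  then have "max_H_minus G h i \<le> max_H_minus G h' i"
    using card_neighbors[OF assms(1)] assms(2) by (intro max_H_minus_mono finite_neighbors) auto
  then show ?thesis using False by (simp add: step_def)
qed (simp add: step_def)

text \<open>
  Removing one maximum and taking the maximum commutes with truncation from above, so a lower bound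
  of the form \<open>min (fixed point) a\<close> improves to \<open>min (fixed point) (a + 1)\<close> in every round.
\<close>

lemma step_min:
  assumes "i \<in> pverts G" "\<And>j. j \<in> N i \<Longrightarrow> min (h' j) a \<le> h j"
  shows "min (step h' i) (a + 1) \<le> step h i"
proof (cases "card (N i) = 1")
  case False
  then obtain j k where jk: "j \<in> N i" "k \<in> N i" "j \<noteq> k" "step h' i \<le> 1 + h' j" "step h' i \<le> 1
      + h' k"
    using step_ge_iff[OF assms(1), of "step h' i" h'] by (simp only: if_False order.refl) blast
  then have "min (step h' i) (a + 1) \<le> 1 + h j" "min (step h' i) (a + 1) \<le> 1 + h k"
    using assms(2)[OF jk(1)] assms(2)[OF jk(2)] by (auto simp: min_def split: if_splits)
  then show ?thesis
    unfolding step_ge_iff[OF assms(1)] using False jk(1-3) by (simp only: if_False) blast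
qed (auto simp: step_def)

lemma step_cong: "(\<And>j. j \<in> N i \<Longrightarrow> h j = h' j) \<Longrightarrow> i \<in> pverts G \<Longrightarrow> step h i = step h' i"
  by (intro antisym step_mono) simp_all

text \<open>Of the two distinct neighbors that witness the new value, at least one is a child.
  Bounds on the children therefore suffice, however large the value of the parent is, and this makes
  induction from the leaves possible.\<close>

lemma step_le_height:
  assumes "c \<in> pverts G" "i \<in> pverts G" "i \<noteq> c"
    and "\<And>k. k \<in> N i \<Longrightarrow> d c k = Suc (d c i) \<Longrightarrow> h k \<le> real (height c k)"
  shows "step h i \<le> real (height c i)"
proof (cases "card (N i) = 1")
  case False
  obtain p where p: "p \<in> N i" "\<And>k. k \<in> N i \<Longrightarrow> k \<noteq> p \<Longrightarrow> d c k = Suc (d c i)"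
    using ex_parent[OF assms(1-3)] by metis
  obtain k where k: "k \<in> N i" "k \<noteq> p" "step h i \<le> 1 + h k"
    using step_ge_iff[OF assms(2), of "step h i" h] False by (metis order.refl)
  have "d c k = Suc (d c i)" using p k by auto
  then show ?thesis
    using assms(4)[of k] height_child[OF assms(1), of k i] k by linarith
qed (auto simp: step_def)

lemma ex_center: obtains c where "c \<in> pverts G" "\<And>r. r \<in> pverts G \<Longrightarrow> ecc c \<le> ecc r"
proof -
  have "pverts G \<noteq> {}" using two_verts by auto
  then show ?thesis
    using ex_is_arg_min_if_finite[OF pair_finite_verts, of ecc] that
    by (auto simp: is_arg_min_def not_less)
qed

section \<open>Values and leadership transfer around a fixed center\<close>

context
  fixes c
  assumes c: "c \<in> pverts G" and ecc_min: "\<And>r. r \<in> pverts G \<Longrightarrow> ecc c \<le> ecc r"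
begin

text \<open>Seen from \<open>k\<close>, nodes in its own branch are within the height of that
  branch; nodes in any other branch cost two extra steps, through \<open>c\<close>.\<close>

lemma ecc_neighbor_le:
  assumes "k \<in> N c" "\<And>j. j \<in> N c \<Longrightarrow> j \<noteq> k \<Longrightarrow> height c j + 2 \<le> n" "height c k \<le> n" "1 \<le> n"
  shows "ecc k \<le> n"
proof (rule ecc_leI)
  show kV: "k \<in> pverts G" using assms(1) neighbor_in_verts by auto
  fix j assume j: "j \<in> pverts G"
  show "d k j \<le> n"
  proof (cases "j = c")
    case True
    then show ?thesis using assms(1,4) hops_neighbor neighbor_sym by auto
  next
    case False
    then obtain m where m: "m \<in> N c" "j \<in> desc c m" using root_branch c j by blast
    show ?thesis
    proof (cases "m = k")
      case True
      then show ?thesis using hops_le_height[OF m(2)] assms(3) by simp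
    next
      case False
      have mV: "m \<in> pverts G" using m neighbor_in_verts by auto
      have "d k j \<le> d k c + d c j" using hops_triangle kV c j by auto
      also have "\<dots> = 2 + d m j"
        using hops_neighbor[OF m(1)] hops_neighbor[OF assms(1)] hops_sym[of k c] m(2)
        by (auto simp: desc_def)
      finally show ?thesis using hops_le_height[OF m(2)] assms(2)[OF m(1) False] by linarith
    qed
  qed
qed

text \<open>If the branch of \<open>k\<close> exceeded every other branch by two or more, moving
  from \<open>c\<close> to \<open>k\<close> would lower the eccentricity.\<close>

lemma center_value_ge:
  assumes k: "k \<in> N c"
  shows "real (height c k) \<le> limit_value c c"
proof (rule ccontr)
  assume "\<not> ?thesis"
  then have less: "step (\<lambda>k. real (height c k)) c < real (height c k)"
    by (simp add: limit_value_def)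
  \<comment> \<open>Supplies the side condition \<open>1 \<le> n\<close> of
    \<open>ecc_neighbor_le\<close>, which accounts for the node \<open>c\<close> itself at distance
    1 from \<open>k\<close>.\<close>
  have "0 < height c k"
  proof (cases "card (N c) = 1")
    case False
    have "0 \<le> step (\<lambda>k. real (height c k)) c"
      using step_ge_iff[OF c, of 0 "\<lambda>k. real (height c k)"] False card_neighbors[OF c]
      by (auto simp: numeral_2_eq_2 card_le_Suc_iff)
    then show ?thesis using less by linarith
  qed (use less in \<open>auto simp: step_def\<close>)
  moreover have "height c j + 2 \<le> height c k" if j: "j \<in> N c" "j \<noteq> k" for j
  proof (rule ccontr)
    assume "\<not> ?thesis"
    then have "real (height c k) \<le> 1 + real (height c j)" by simp
    then have "\<exists>j\<in>N c. \<exists>m\<in>N c. j \<noteq> m \<and> real (height c k) \<le> 1 + real (height c j)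
        \<and> real (height c k) \<le> 1 + real (height c m)"
      using j k by (intro bexI[of _ j] bexI[of _ k]) auto
    then have "real (height c k) \<le> step (\<lambda>k. real (height c k)) c"
      using two_neighbors[OF j(1) k j(2)] by (subst step_ge_iff[OF c]) auto
    then show False using less by simp
  qed
  ultimately have "ecc k \<le> height c k"
    using k by (intro ecc_neighbor_le) auto
  moreover have "Suc (height c k) \<le> ecc c"
    using height_child[OF c k] root_neighbor[OF k] ecc_eq_height by auto
  ultimately show False using ecc_min[of k] k neighbor_in_verts by force
qed

lemma limit_value_root: "limit_value c c = step (limit_value c) c"
proof -
  have "step (limit_value c) c = step (\<lambda>k. real (height c k)) c"
    using c neighbor_neq by (intro step_cong) (auto simp: limit_value_def)
  then show ?thesis by (simp add: limit_value_def)
qed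

text \<open>Strictness can fail only on an edge at the root, where equality will turn out to mark a
  second center.\<close>

lemma parent_value_ge:
  assumes "i \<in> pverts G" "i \<noteq> c" "p \<in> N i" "Suc (d c p) = d c i"
  shows "limit_value c i \<le> limit_value c p" "p \<noteq> c \<Longrightarrow> limit_value c i < limit_value c p"
proof -
  have ip: "i \<in> N p" using assms neighbor_sym by auto
  show 1: "limit_value c i < limit_value c p" if "p \<noteq> c"
    using height_child[OF c ip] assms that by (simp add: limit_value_def)
  show "limit_value c i \<le> limit_value c p"
    using 1 center_value_ge[of i] ip assms(2) by (cases "p = c") (auto simp: limit_value_def)
qed

lemma child_value_less:
  assumes "k \<in> N i" "d c k = Suc (d c i)" "i \<noteq> c"
  shows "limit_value c k < limit_value c i"
  using height_child[OF c assms(1,2)] assms by (auto simp: limit_value_def)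

text \<open>At a node other than \<open>c\<close> the parent has a value at least as large as the
  node itself, hence larger than all children. It absorbs the deletion, and the highest child
  determines the new value.\<close>

lemma limit_value_fixed:
  assumes i: "i \<in> pverts G"
  shows "step (limit_value c) i = limit_value c i"
proof (cases "i = c")
  case True
  then show ?thesis using limit_value_root by simp
next
  case False
  obtain p where p: "p \<in> N i" "Suc (d c p) = d c i"
    "\<And>k. k \<in> N i \<Longrightarrow> k \<noteq> p \<Longrightarrow> d c k = Suc (d c i)"
    using ex_parent[OF c i False] by metis
  show ?thesis
  proof (rule antisym)
    show "step (limit_value c) i \<le> limit_value c i"
    proof -
      have "limit_value c k \<le> real (height c k)" if "d c k = Suc (d c i)" for k
        using that by (cases "k = c") (auto simp: limit_value_def)
      then have "step (limit_value c) i \<le> real (height c i)"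
        using c i False by (intro step_le_height) auto
      then show ?thesis using False by (simp add: limit_value_def)
    qed
    show "limit_value c i \<le> step (limit_value c) i"
    proof (cases "height c i = 0")
      case True
      have "card (N i) = 1"
      proof (rule ccontr)
        assume "card (N i) \<noteq> 1"
        then have "N i \<noteq> {p}" by auto
        then obtain k where "k \<in> N i" "k \<noteq> p" using p(1) by auto
        then show False using p(3) height_child[OF c, of k i] True by auto
      qed
      then show ?thesis using True False by (simp add: step_def limit_value_def)
    next
      case height: False
      then obtain k where k: "k \<in> N i" "d c k = Suc (d c i)" "height c i = Suc (height c k)"
        using height_pos_child[OF c i] by auto
      have kp: "k \<noteq> p" using k p by auto
      have "k \<noteq> c" using k(2) by auto
      then have "limit_value c i \<le> 1 + limit_value c k" using k False by (simp add: limit_value_def)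
      moreover have "limit_value c i \<le> 1 + limit_value c p"
        using parent_value_ge(1)[OF i False p(1,2)] by simp
      moreover have "card (N i) \<noteq> 1" using two_neighbors[OF k(1) p(1) kp] by simp
      ultimately show ?thesis
        using k(1) p(1) kp by (subst step_ge_iff[OF i]) auto
    qed
  qed
qed

lemma value_eventually:
  "\<exists>T. \<forall>t\<ge>T. \<forall>i\<in>pverts G. ls_mv_value G h0 t i = limit_value c i"
proof -
  \<comment> \<open>A lower bound for all initial values: truncated at \<open>m\<close>, the fixed
    point lies below the initial state, and every round lifts the truncation level by one.\<close>
  define m where "m = Min (h0 ` pverts G)"
  have lower: "min (limit_value c i) (m + real t) \<le> ls_mv_value G h0 t i" if "i \<in> pverts G" for i t
    using that
  proof (induction t arbitrary: i)
    case 0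
    then show ?case using pair_finite_verts by (auto simp: m_def min_le_iff_disj)
  next
    case (Suc t)
    have "min (step (limit_value c) i) (m + real t + 1) \<le> step (ls_mv_value G h0 t) i"
      using Suc neighbor_in_verts by (intro step_min) auto
    then show ?case
      unfolding ls_mv_value_step limit_value_fixed[OF Suc.prems]
          by (simp add: add.assoc add.commute)
  qed
  \<comment> \<open>Strict inequality, because a leaf (height 0) is reset to 0 only in the first
    round; each further level costs one more round.\<close>
  have upper: "ls_mv_value G h0 t i \<le> real (height c i)"
    if "i \<in> pverts G" "i \<noteq> c" "height c i < t" for i t
    using that
  proof (induction t arbitrary: i)
    case (Suc t)
    have "ls_mv_value G h0 t k \<le> real (height c k)" if k: "k \<in> N i" "d c k = Suc (d c i)" for k
    proof (rule Suc.IH)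
      show "k \<in> pverts G" using k neighbor_in_verts by auto
      show "k \<noteq> c" using k by auto
      show "height c k < t" using height_child[OF c k] Suc.prems by simp
    qed
    then show ?case unfolding ls_mv_value_step using Suc.prems c by (intro step_le_height) auto
  qed auto
  define B where "B = Max (limit_value c ` pverts G)"
  obtain T1 where T1: "B - m \<le> real T1" using real_arch_simple by blast
  have height_le: "height c i \<le> ecc c" if iV: "i \<in> pverts G" for i
  proof -
    obtain j where "j \<in> desc c i" "d i j = height c i" by (rule height_attained[OF iV])
    then show ?thesis using hops_le_ecc[of j c] by (simp add: desc_def)
  qed
  \<comment> \<open>The other nodes are bounded above after \<open>ecc c + 1\<close> rounds;
    \<open>c\<close> reads their values and follows one round later.\<close>
  define T where "T = max T1 (ecc c + 2)"
  have "ls_mv_value G h0 t i = limit_value c i" if t: "T \<le> t" and i: "i \<in> pverts G" for t i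
  proof (rule antisym)
    have "limit_value c i \<le> B" unfolding B_def using pair_finite_verts i by auto
    also have "\<dots> \<le> m + real t" using T1 t by (auto simp: T_def)
    finally show "limit_value c i \<le> ls_mv_value G h0 t i" using lower[OF i, of t] by auto
    show "ls_mv_value G h0 t i \<le> limit_value c i"
    proof (cases "i = c")
      case False
      then show ?thesis using upper[OF i False, of t] height_le[OF i] t
        by (auto simp: T_def limit_value_def)
    next
      case True
      obtain s where s: "t = Suc s" "ecc c < s" using t by (cases t) (auto simp: T_def)
      have "step (ls_mv_value G h0 s) c \<le> step (limit_value c) c"
      proof (rule step_mono[OF c])
        fix j assume "j \<in> N c"
        then have j: "j \<in> pverts G" "j \<noteq> c" using neighbor_in_verts neighbor_neq by auto
        then show "ls_mv_value G h0 s j \<le> limit_value c j"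
          using upper[OF j, of s] height_le[OF j(1)] s by (auto simp: limit_value_def)
      qed
      then show ?thesis unfolding s True ls_mv_value_step using limit_value_root by simp
    qed
  qed
  then show ?thesis by blast
qed

text \<open>Another branch as high as that of \<open>i\<close> would give \<open>c\<close> a value
  of at least one plus the height of \<open>i\<close>. So under equality \<open>i\<close> heads the
  unique highest branch, and moving there does not increase the eccentricity.\<close>

lemma stationary_optimal:
  assumes i: "i \<in> N c" and eq: "limit_value c i = limit_value c c"
  shows "ecc i \<le> ecc c"
proof (rule ecc_neighbor_le[OF i])
  have ic: "i \<noteq> c" using i neighbor_neq by auto
  have hi: "Suc (height c i) \<le> ecc c"
    using height_child[OF c i] root_neighbor[OF i] ecc_eq_height by auto
  then show "height c i \<le> ecc c" "1 \<le> ecc c" by auto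
  fix j assume j: "j \<in> N c" "j \<noteq> i"
  have "height c j < height c i"
  proof (rule ccontr)
    assume "\<not> ?thesis"
    then have "\<exists>j\<in>N c. \<exists>m\<in>N c. j \<noteq> m \<and> 1 + real (height c i) \<le> 1 + real (height c j)
        \<and> 1 + real (height c i) \<le> 1 + real (height c m)"
      using i j by (intro bexI[of _ j] bexI[of _ i]) auto
    then have "1 + real (height c i) \<le> step (\<lambda>k. real (height c k)) c"
      using two_neighbors[OF j(1) i j(2)] by (subst step_ge_iff[OF c]) auto
    then show False using eq ic by (simp add: limit_value_def)
  qed
  then show "height c j + 2 \<le> ecc c" using hi by simp
qed

lemma leader_eventually:
  assumes "ls_mv_run G h0 l0 l" "l0 \<in> pverts G"
  shows "(\<forall>t. l t \<in> pverts G) \<and> (\<forall>t. l (Suc t) = l t \<or> l (Suc t) \<in> N (l t))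
     \<and> (\<exists>T0 u. u \<in> pverts G \<and> ecc u = ecc c \<and> (\<forall>t\<ge>T0. l t = u))"
proof -
  let ?h = "ls_mv_value G h0"
  have l0: "l 0 = l0" and l_stay: "\<not> (\<exists>j\<in>N (l t). ?h t j > ?h (Suc t) (l t)) \<Longrightarrow> l (Suc t) = l t"
    and l_move: "\<exists>j\<in>N (l t). ?h t j > ?h (Suc t) (l t)
        \<Longrightarrow> is_arg_max (?h t) (\<lambda>j. j \<in> N (l t)) (l (Suc t))"
    for t using assms(1)[unfolded ls_mv_run_def, THEN conjunct2, rule_format, of t]
      assms(1)[unfolded ls_mv_run_def, THEN conjunct1] by (simp_all split: if_splits)
  have move: "l (Suc t) = l t \<or> l (Suc t) \<in> N (l t)" for t
    using l_stay[of t] l_move[of t] by (auto simp: is_arg_max_def)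
  have V: "l t \<in> pverts G" for t
    by (induction t) (use l0 assms(2) move neighbor_in_verts in metis)+
  obtain T where T: "\<And>t i. T \<le> t \<Longrightarrow> i \<in> pverts G \<Longrightarrow> ?h t i = limit_value c i"
    using value_eventually by blast
  \<comment> \<open>Each round after stabilization either rests at a center or moves strictly closer
    to \<open>c\<close>; the distance to \<open>c\<close> cannot drop forever.\<close>
  have progress: "(l (Suc t) = l t \<and> ecc (l t) = ecc c) \<or> d c (l (Suc t)) < d c (l t)" if t: "T
      \<le> t" for t
  proof -
    define i where "i = l t"
    have iV: "i \<in> pverts G" using V i_def by auto
    have hN: "?h t j = limit_value c j" if "j \<in> N i" for j using T t that neighbor_in_verts by auto
    have hi: "?h (Suc t) i = limit_value c i" using T[of "Suc t"] t iV by auto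
    have cond: "(\<exists>j\<in>N i. ?h t j > ?h (Suc t) i) \<longleftrightarrow> (\<exists>j\<in>N i. limit_value c j > limit_value c i)"
      using hN hi by (intro bex_cong) auto
    show ?thesis
    proof (cases "i = c")
      case True
      have "limit_value c j \<le> limit_value c c" if "j \<in> N c" for j
        using center_value_ge[OF that] neighbor_neq[OF that] by (simp add: limit_value_def)
      then have "l (Suc t) = l t" using l_stay[of t] cond True unfolding i_def[symmetric]
          by (metis not_less)
      then show ?thesis using True i_def by auto
    next
      case False
      obtain p where p: "p \<in> N i" "Suc (d c p) = d c i"
        "\<And>k. k \<in> N i \<Longrightarrow> k \<noteq> p \<Longrightarrow> d c k = Suc (d c i)"
        using ex_parent[OF c iV False] by metis
      have child: "limit_value c k < limit_value c i" if "k \<in> N i" "k \<noteq> p" for k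
        using child_value_less p(3) that False by auto
      \<comment> \<open>Children have strictly smaller values, so only the parent can attract the
        leader. When it does, it is the unique maximizer and the tie-breaking rule is
        irrelevant.\<close>
      show ?thesis
      proof (cases "limit_value c i < limit_value c p")
        case True
        then have "is_arg_max (?h t) (\<lambda>j. j \<in> N i) (l (Suc t))"
          using l_move[of t] cond p(1) by (auto simp: i_def)
        then have "l (Suc t) \<in> N i" "\<not> ?h t (l (Suc t)) < ?h t p"
          using p(1) by (auto simp: is_arg_max_def)
        then have "l (Suc t) = p"
          using child[of "l (Suc t)"] True hN p(1) by force
        then show ?thesis using p(2) i_def by auto
      next
        case le: False
        then have eq: "limit_value c i = limit_value c p" "p = c"
          using parent_value_ge[OF iV False p(1,2)] by auto
        then have "l (Suc t) = l t"
        proof -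
          have "\<not> limit_value c i < limit_value c j" if "j \<in> N i" for j
            using child[OF that] le by (cases "j = p") auto
          then show ?thesis using l_stay[of t] cond unfolding i_def[symmetric] by blast
        qed
        moreover have "ecc i \<le> ecc c"
          using stationary_optimal[of i] eq p(1) neighbor_sym by auto
        ultimately show ?thesis using ecc_min[OF iV] i_def by auto
      qed
    qed
  qed
  have "\<exists>t\<ge>T. l (Suc t) = l t \<and> ecc (l t) = ecc c"
  proof (rule ccontr)
    assume neg: "\<not> ?thesis"
    have "d c (l (T + n)) + n \<le> d c (l T)" for n
    proof (induction n)
      case (Suc n)
      then show ?case using progress[of "T + n"] neg by auto
    qed simp
    from this[of "Suc (d c (l T))"] show False by simp
  qed
  then obtain T0 where T0: "T \<le> T0" "ecc (l T0) = ecc c" "l (Suc T0) = l T0" by auto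
  \<comment> \<open>The values no longer change, so the decision to stay, once taken, is repeated in
    every later round.\<close>
  have "l (T0 + n) = l T0" for n
  proof (induction n)
    case (Suc n)
    let ?cond = "\<lambda>t. \<exists>j\<in>N (l t). ?h t j > ?h (Suc t) (l t)"
    have hT: "?h (T0 + n) j = ?h T0 j" "?h (Suc (T0 + n)) j = ?h (Suc T0) j" if "j \<in> pverts G" for j
      using T that T0(1) by auto
    have "\<not> ?cond T0"
    proof
      assume "?cond T0"
      then have "l (Suc T0) \<in> N (l T0)" using l_move by (auto simp: is_arg_max_def)
      then show False using T0(3) neighbor_neq by auto
    qed
    moreover have "?cond (T0 + n) \<longleftrightarrow> ?cond T0"
      using hT neighbor_in_verts V[of T0] unfolding Suc by (intro bex_cong) auto
    ultimately have "\<not> ?cond (T0 + n)" by blast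
    then show ?case using l_stay[of "T0 + n"] Suc by simp
  qed simp
  then have "\<forall>t\<ge>T0. l t = l T0" by (metis le_add_diff_inverse)
  then show ?thesis using V move T0(2) by blast
qed

end

section \<open>Existence of runs and self-stabilization\<close>

lemma ex_run:
  assumes "l0 \<in> pverts G"
  shows "\<exists>l. ls_mv_run G h0 l0 l"
proof -
  let ?h = "ls_mv_value G h0"
  \<comment> \<open>The initial leader enters the invariant through the clause for
    \<open>t = 0\<close>, so that dependent choice starts the sequence there.\<close>
  have "\<exists>l. \<forall>t::nat. (l t \<in> pverts G \<and> (t = 0 \<longrightarrow> l t = l0)) \<and>
     (if \<exists>j\<in>N (l t). ?h t j > ?h (Suc t) (l t)
      then is_arg_max (?h t) (\<lambda>j. j \<in> N (l t)) (l (Suc t)) else l (Suc t) = l t)"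
  proof (rule dependent_nat_choice)
    fix i and t :: nat assume "i \<in> pverts G \<and> (t = 0 \<longrightarrow> i = l0)"
    then have i: "i \<in> pverts G" by simp
    have "Max (?h t ` N i) \<in> ?h t ` N i"
      using finite_neighbors neighbors_nonempty[OF i] by (intro Max_in) auto
    then obtain k where "k \<in> N i" "?h t k = Max (?h t ` N i)" by auto
    then have k: "is_arg_max (?h t) (\<lambda>j. j \<in> N i) k"
      using finite_neighbors by (auto simp: is_arg_max_linorder)
    then have "k \<in> pverts G" using neighbor_in_verts by (auto simp: is_arg_max_def)
    then show "\<exists>k. (k \<in> pverts G \<and> (Suc t = 0 \<longrightarrow> k = l0)) \<and>
      (if \<exists>j\<in>N i. ?h t j > ?h (Suc t) i then is_arg_max (?h t) (\<lambda>j. j \<in> N i) k else k = i)"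
      using k i by auto
  qed (use assms in auto)
  then obtain l where "\<forall>t::nat. (l t \<in> pverts G \<and> (t = 0 \<longrightarrow> l t = l0)) \<and>
     (if \<exists>j\<in>N (l t). ?h t j > ?h (Suc t) (l t)
      then is_arg_max (?h t) (\<lambda>j. j \<in> N (l t)) (l (Suc t)) else l (Suc t) = l t)" ..
  then have "ls_mv_run G h0 l0 l" unfolding ls_mv_run_def by simp
  then show ?thesis by blast
qed

text \<open>\<open>optimal\<close> is abstract and tied to eccentricity only, which separates the
  combinatorial argument from the probabilistic identification of optimal leaders.\<close>

lemma self_stabilizing:
  assumes "\<And>u. optimal u \<longleftrightarrow> is_arg_min ecc (\<lambda>v. v \<in> pverts G) u"
  shows "self_stabilizing_leader_selection G optimal (ls_mv_run G)"
proof -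
  obtain c where c: "c \<in> pverts G" "\<And>r. r \<in> pverts G \<Longrightarrow> ecc c \<le> ecc r" using ex_center by metis
  have opt: "optimal u" if "u \<in> pverts G" "ecc u = ecc c" for u
    using c that by (auto simp: assms is_arg_min_def not_less)
  show ?thesis unfolding self_stabilizing_leader_selection_def
  proof (intro allI ballI conjI impI)
    fix h0 l0 assume l0: "l0 \<in> pverts G"
    show "\<exists>l. ls_mv_run G h0 l0 l" using ex_run l0 by blast
    fix l assume "ls_mv_run G h0 l0 l"
    from leader_eventually[OF c this l0] opt
    show "\<exists>T0 u. optimal u \<and> (\<forall>t\<ge>T0. l t = u)"
      "l t \<in> pverts G" "l (Suc t) = l t \<or> l (Suc t) \<in> N (l t)" for t by blast+
  qed
qed

end

section \<open>The heat equation with an absorbing node\<close>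

text \<open>The exponential series of \<open>s A\<close> applied to \<open>c\<close>, kept
  componentwise as power series in \<open>s\<close>. With \<open>R\<close> the sum of all absolute
  entries of \<open>A\<close>, the coefficients are at most \<open>C * R ^ k / fact k\<close>, so
  the series converge everywhere and may be differentiated termwise.\<close>

lemma ex_linear_flow:
  fixes A :: "'a \<Rightarrow> 'a \<Rightarrow> real" and c :: "'a \<Rightarrow> real"
  assumes V: "finite V"
  obtains \<phi> :: "real \<Rightarrow> 'a \<Rightarrow> real" where
    "\<And>i. i \<in> V \<Longrightarrow> \<phi> 0 i = c i"
    "\<And>i s. i \<in> V \<Longrightarrow> ((\<lambda>s. \<phi> s i) has_real_derivative (\<Sum>j\<in>V. A i j * \<phi> s j)) (at s)"
proof -
  define T where "T f i = (\<Sum>j\<in>V. A i j * f j)" for f :: "'a \<Rightarrow> real" and i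
  define R where "R = (\<Sum>i\<in>V. \<Sum>j\<in>V. \<bar>A i j\<bar>)"
  define C where "C = (\<Sum>i\<in>V. \<bar>c i\<bar>)"
  define a where "a i k = (T ^^ k) c i / fact k" for i k
  have R: "0 \<le> R" unfolding R_def by (intro sum_nonneg) auto
  have bound: "\<bar>(T ^^ k) c i\<bar> \<le> C * R ^ k" if "i \<in> V" for i k
    using that
  proof (induction k arbitrary: i)
    case 0
    then show ?case using member_le_sum[OF 0 _ V, of "\<lambda>i. \<bar>c i\<bar>"] by (simp add: C_def)
  next
    case (Suc k)
    have "\<bar>(T ^^ Suc k) c i\<bar> \<le> (\<Sum>j\<in>V. \<bar>A i j\<bar> * \<bar>(T ^^ k) c j\<bar>)"
      by (simp add: T_def) (metis (mono_tags, lifting) abs_mult sum_abs sum.cong)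
    also have "\<dots> \<le> (\<Sum>j\<in>V. \<bar>A i j\<bar> * (C * R ^ k))"
      by (intro sum_mono mult_left_mono Suc.IH) auto
    also have "\<dots> = (\<Sum>j\<in>V. \<bar>A i j\<bar>) * (C * R ^ k)" by (simp add: sum_distrib_right)
    also have "\<dots> \<le> R * (C * R ^ k)"
    proof (rule mult_right_mono)
      show "(\<Sum>j\<in>V. \<bar>A i j\<bar>) \<le> R"
        unfolding R_def using Suc.prems by (intro member_le_sum[of i]) (auto intro: sum_nonneg V)
      show "0 \<le> C * R ^ k" unfolding C_def using R by (intro mult_nonneg_nonneg sum_nonneg) auto
    qed
    finally show ?case by (simp add: mult_ac)
  qed
  have summable: "summable (\<lambda>k. a i k * s ^ k)" if "i \<in> V" for i s
  proof (rule summable_comparison_test')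
    show "summable (\<lambda>k. C * (inverse (fact k) * (R * \<bar>s\<bar>) ^ k))"
      by (intro summable_mult summable_exp)
    show "norm (a i k * s ^ k) \<le> C * (inverse (fact k) * (R * \<bar>s\<bar>) ^ k)" if "0 \<le> k" for k
    proof -
      have "\<bar>(T ^^ k) c i\<bar> * (inverse (fact k) * \<bar>s\<bar> ^ k)
          \<le> C * R ^ k * (inverse (fact k) * \<bar>s\<bar> ^ k)"
        by (intro mult_right_mono bound \<open>i \<in> V\<close>) auto
      then show ?thesis by (simp add: a_def abs_mult power_abs field_simps power_mult_distrib)
    qed
  qed
  define \<phi> where "\<phi> s i = (\<Sum>k. a i k * s ^ k)" for s i
  have "\<phi> 0 i = c i" for i
    unfolding \<phi>_def by (subst powser_zero) (simp add: a_def)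
  moreover have "((\<lambda>s. \<phi> s i) has_real_derivative (\<Sum>j\<in>V. A i j * \<phi> s j)) (at s)" if i: "i \<in> V"
      for i s
  proof -
    have "real (Suc k) * ((T ^^ Suc k) c i / fact (Suc k)) = (T ^^ Suc k) c i / fact k" for k
      by (simp add: field_simps del: funpow.simps of_nat_Suc)
    then have "diffs (a i) k = (\<Sum>j\<in>V. A i j * a j k)" for k
      by (simp add: diffs_def a_def T_def sum_divide_distrib del: of_nat_Suc fact_Suc)
    then have "(\<Sum>k. diffs (a i) k * s ^ k) = (\<Sum>k. \<Sum>j\<in>V. A i j * (a j k * s ^ k))"
      by (simp add: sum_distrib_right mult.assoc)
    also have "\<dots> = (\<Sum>j\<in>V. \<Sum>k. A i j * (a j k * s ^ k))"
      by (intro suminf_sum summable_mult summable)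
    also have "\<dots> = (\<Sum>j\<in>V. A i j * \<phi> s j)"
      unfolding \<phi>_def by (intro sum.cong refl suminf_mult summable)
    finally show ?thesis
      using termdiffs_strong_converges_everywhere[of "a i" s, OF summable[OF i]]
      unfolding \<phi>_def by simp
  qed
  ultimately show ?thesis using that by blast
qed

definition laplacian :: "'a pair_pre_digraph \<Rightarrow> ('a \<Rightarrow> real) \<Rightarrow> 'a \<Rightarrow> real" where
  "laplacian G f i = (\<Sum>j\<in>neighbors G i. f i - f j)"

section \<open>Energy form, decay and existence of the grounded heat flow; its kernel on a
  tree\<close>

context tree_graph begin

text \<open>Every undirected edge is counted in both orientations, hence the factor 2 in
  \<open>laplacian_inner\<close>.\<close>

definition dirichlet :: "('a \<Rightarrow> real) \<Rightarrow> ('a \<Rightarrow> real) \<Rightarrow> real" where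
  "dirichlet f g = (\<Sum>(i, j)\<in>parcs G. (f i - f j) * (g i - g j))"

lemma laplacian_inner_arcs:
  "(\<Sum>i\<in>pverts G. g i * laplacian G f i) = (\<Sum>(i, j)\<in>parcs G. g i * (f i - f j))"
proof -
  have "(\<Sum>i\<in>pverts G. g i * laplacian G f i)
      = (\<Sum>(i, j)\<in>Sigma (pverts G) N. g i * (f i - f j))"
    unfolding laplacian_def sum_distrib_left
    using pair_finite_verts finite_neighbors by (subst sum.Sigma) auto
  also have "Sigma (pverts G) N = parcs G"
    by (auto simp: neighbors_def dest: in_arcsD1)
  finally show ?thesis .
qed

lemma laplacian_inner: "2 * (\<Sum>i\<in>pverts G. g i * laplacian G f i) = dirichlet f g"
proof -
  have "(\<Sum>(i, j)\<in>parcs G. g i * (f i - f j)) = (\<Sum>(i, j)\<in>parcs G. g j * (f j - f i))"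
    by (rule sum.reindex_bij_witness[of _ prod.swap prod.swap]) (auto intro: arcs_symmetric)
  then have "2 * (\<Sum>i\<in>pverts G. g i * laplacian G f i)
    = (\<Sum>(i, j)\<in>parcs G. g i * (f i - f j)) + (\<Sum>(i, j)\<in>parcs G. g j * (f j - f i))"
    by (simp add: laplacian_inner_arcs)
  also have "\<dots> = dirichlet f g"
    unfolding dirichlet_def sum.distrib[symmetric] by (intro sum.cong) (auto simp: algebra_simps)
  finally show ?thesis .
qed

lemma laplacian_symmetric:
  "(\<Sum>i\<in>pverts G. g i * laplacian G f i) = (\<Sum>i\<in>pverts G. f i * laplacian G g i)"
proof -
  have "dirichlet f g = dirichlet g f" unfolding dirichlet_def by (simp add: mult.commute)
  then show ?thesis using laplacian_inner[of g f] laplacian_inner[of f g] by simp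
qed

text \<open>Symmetry of the follower submatrix: for functions vanishing at \<open>u\<close>, the
  term at \<open>u\<close> drops out of both sides.\<close>

lemma laplacian_symmetric_vanishing:
  assumes "u \<in> pverts G" "f u = 0" "g u = 0"
  shows "(\<Sum>i\<in>pverts G - {u}. g i * laplacian G f i) = (\<Sum>i\<in>pverts G - {u}. f i * laplacian G g i)"
  using laplacian_symmetric[of g f] assms pair_finite_verts by (simp add: sum.remove[of _ u])

text \<open>Telescoping along a shortest path from \<open>u\<close>: each edge changes the function
  by at most the root of the energy.\<close>

lemma abs_le_hops_dirichlet:
  assumes "u \<in> pverts G" "f u = 0" "i \<in> pverts G"
  shows "\<bar>f i\<bar> \<le> d u i * sqrt (dirichlet f f)"
  using assms(3)
proof (induction "d u i" arbitrary: i)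
  case 0
  then have "u = i" using hops_eq_0D[OF assms(1)] by metis
  then show ?case using assms(2) by simp
next
  case (Suc n)
  then have "i \<noteq> u" by auto
  then obtain j where j: "j \<in> N i" "Suc (d u j) = d u i"
    using ex_closer_neighbor[OF assms(1) Suc.prems] by auto
  have "(f i - f j)\<^sup>2 \<le> dirichlet f f"
    unfolding dirichlet_def
    using member_le_sum[of "(i, j)" "parcs G" "\<lambda>(i, j). (f i - f j) * (f i
        - f j)"] j(1) pair_finite_arcs
    by (auto simp: neighbors_def power2_eq_square)
  then have "\<bar>f i - f j\<bar> \<le> sqrt (dirichlet f f)" by (simp add: real_le_rsqrt)
  moreover have "\<bar>f j\<bar> \<le> d u j * sqrt (dirichlet f f)"
    using Suc j neighbor_in_verts by auto
  moreover have "real (d u i) * sqrt (dirichlet f f) = d u j * sqrt (dirichlet f f)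
      + sqrt (dirichlet f f)"
    using j(2)[symmetric] by (simp add: algebra_simps)
  ultimately show ?case by linarith
qed

lemma dirichlet_nonneg: "0 \<le> dirichlet f f"
  unfolding dirichlet_def by (intro sum_nonneg) auto

text \<open>Quantitative positive definiteness of the follower submatrix. The constant is crude; any
  finite one yields exponential decay.\<close>

lemma poincare:
  assumes "u \<in> pverts G" "f u = 0"
  shows "(\<Sum>i\<in>pverts G. (f i)\<^sup>2) \<le> (\<Sum>i\<in>pverts G. (real (d u i))\<^sup>2) * dirichlet f f"
  unfolding sum_distrib_right
proof (rule sum_mono)
  fix i assume "i \<in> pverts G"
  from abs_le_hops_dirichlet[of u f, OF assms this]
  have "(f i)\<^sup>2 \<le> (d u i * sqrt (dirichlet f f))\<^sup>2" by (intro power2_le_iff_abs_le[THEN iffD2]) auto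
  then show "(f i)\<^sup>2 \<le> (real (d u i))\<^sup>2 * dirichlet f f"
    using dirichlet_nonneg by (simp add: power_mult_distrib)
qed

text \<open>The semigroup exp(-s L) of the follower submatrix L, extended by zero to
  \<open>u\<close>. Time runs over all reals, so derivatives are two-sided and the reversal of time
  at \<open>t\<close> meets no boundary.\<close>

definition dirichlet_flow :: "'a \<Rightarrow> (real \<Rightarrow> 'a \<Rightarrow> real) \<Rightarrow> bool" where
  "dirichlet_flow u \<phi> \<longleftrightarrow> (\<forall>s. \<phi> s u = 0) \<and>
     (\<forall>i\<in>pverts G - {u}. \<forall>s. ((\<lambda>s. \<phi> s i) has_real_derivative - laplacian G (\<phi> s) i) (at s))"

lemma dirichlet_flow_inner:
  assumes u: "u \<in> pverts G" and \<phi>: "dirichlet_flow u \<phi>" and \<psi>: "dirichlet_flow u \<psi>"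
  shows "((\<lambda>s. \<Sum>i\<in>pverts G. \<phi> s i * \<psi> s i) has_real_derivative
           - 2 * (\<Sum>i\<in>pverts G. \<phi> s i * laplacian G (\<psi> s) i)) (at s)"
proof -
  have vanish: "\<phi> s u = 0" "\<psi> s u = 0" for s using assms by (auto simp: dirichlet_flow_def)
  have "((\<lambda>s. \<Sum>i\<in>pverts G - {u}. \<phi> s i * \<psi> s i) has_real_derivative
     (\<Sum>i\<in>pverts G - {u}. - laplacian G (\<phi> s) i * \<psi> s i + - laplacian G (\<psi> s) i * \<phi> s i)) (at s)"
    using \<phi> \<psi> by (intro DERIV_sum DERIV_mult) (auto simp: dirichlet_flow_def)
  moreover have "(\<Sum>i\<in>pverts G - {u}. - laplacian G (\<phi> s) i * \<psi> s i + - laplacian G (\<psi> s) i * \<phi> s i)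
     = - (\<Sum>i\<in>pverts G - {u}. \<psi> s i * laplacian G (\<phi> s) i) - (\<Sum>i\<in>pverts G
         - {u}. \<phi> s i * laplacian G (\<psi> s) i)"
    by (simp add: sum.distrib sum_negf mult.commute sum_subtractf)
  ultimately show ?thesis
    using laplacian_symmetric_vanishing[of u "\<phi> s" "\<psi> s"] vanish u pair_finite_verts
    by (simp add: sum.remove[of _ u])
qed

text \<open>Gronwall: \<open>poincare\<close> bounds the rate of loss of \<open>E\<close> below by
  \<open>E / C\<close>, so \<open>E s * exp (s / C)\<close> is nonincreasing.\<close>

lemma dirichlet_flow_decay:
  assumes u: "u \<in> pverts G" and \<phi>: "dirichlet_flow u \<phi>"
  shows "((\<lambda>s. \<Sum>i\<in>pverts G. (\<phi> s i)\<^sup>2) \<longlongrightarrow> 0) at_top"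
proof -
  define E where "E s = (\<Sum>i\<in>pverts G. (\<phi> s i)\<^sup>2)" for s
  define C where "C = 1 + (\<Sum>i\<in>pverts G. (real (d u i))\<^sup>2)"
  have C: "0 < C" unfolding C_def by (intro add_pos_nonneg sum_nonneg) auto
  have E': "(E has_real_derivative - dirichlet (\<phi> s) (\<phi> s)) (at s)" for s
    using dirichlet_flow_inner[OF u \<phi> \<phi>, of s] laplacian_inner[of "\<phi> s" "\<phi> s"]
    by (simp add: E_def[abs_def] power2_eq_square)
  have E_le: "E s \<le> C * dirichlet (\<phi> s) (\<phi> s)" for s
    using poincare[OF u, of "\<phi> s"] \<phi> dirichlet_nonneg[of "\<phi> s"]
    by (simp add: dirichlet_flow_def E_def C_def distrib_right)
  have "E s * exp (s / C) \<le> E 0 * exp (0 / C)" if "0 \<le> s" for s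
  proof (rule DERIV_nonpos_imp_nonincreasing[OF that])
    fix r :: real
    have "((\<lambda>s. E s * exp (s / C)) has_real_derivative
        - dirichlet (\<phi> r) (\<phi> r) * exp (r / C) + exp (r / C) * (1 / C) * E r) (at r)"
      by (intro DERIV_mult E' derivative_eq_intros refl) (use C in auto)
    moreover have "- dirichlet (\<phi> r) (\<phi> r) * exp (r / C) + exp (r / C) * (1 / C) * E r
        = exp (r / C) * (E r - C * dirichlet (\<phi> r) (\<phi> r)) / C"
      using C by (simp add: field_simps)
    moreover have "\<dots> \<le> 0"
      using E_le[of r] C by (intro divide_nonpos_pos mult_nonneg_nonpos) auto
    ultimately show "\<exists>y. ((\<lambda>s. E s * exp (s / C)) has_real_derivative y) (at r) \<and> y \<le> 0"
      by metis
  qed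
  then have le: "E s \<le> E 0 * exp (- s / C)" if "0 \<le> s" for s
    using that by (simp add: exp_minus field_simps)
  have "((\<lambda>s. E 0 * exp (- s / C)) \<longlongrightarrow> 0) at_top"
    using C by real_asymp
  then have "(E \<longlongrightarrow> 0) at_top"
  proof (rule tendsto_sandwich[OF _ _ tendsto_const, rotated -1])
    show "\<forall>\<^sub>F s in at_top. 0 \<le> E s" unfolding E_def
        by (intro always_eventually allI sum_nonneg) simp
    show "\<forall>\<^sub>F s in at_top. E s \<le> E 0 * exp (- s / C)"
      using eventually_ge_at_top[of 0] by eventually_elim (rule le)
  qed
  then show ?thesis by (simp add: E_def[abs_def])
qed

lemma ex_dirichlet_flow:
  assumes u: "u \<in> pverts G" and c: "c u = 0"
  obtains \<phi> where "dirichlet_flow u \<phi>" "\<And>i. i \<in> pverts G \<Longrightarrow> \<phi> 0 i = c i"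
proof -
  \<comment> \<open>The zero row at \<open>u\<close> freezes that component at its initial value 0;
    the other rows are those of the negative Laplacian.\<close>
  define A :: "'a \<Rightarrow> 'a \<Rightarrow> real" where
    "A i j = (if i = u then 0 else (if j \<in> N i then 1 else 0) - (if j
        = i then real (card (N i)) else 0))" for i j
  obtain \<phi> where \<phi>0: "\<And>i. i \<in> pverts G \<Longrightarrow> \<phi> 0 i = c i" and
    \<phi>': "\<And>i s. i \<in> pverts G \<Longrightarrow> ((\<lambda>s. \<phi> s i) has_real_derivative (\<Sum>j\<in>pverts G. A i j * \<phi> s j)) (at s)"
    using ex_linear_flow[OF pair_finite_verts, of c A] by metis
  have A: "(\<Sum>j\<in>pverts G. A i j * f j) = - laplacian G f i" if "i \<in> pverts G - {u}" for f i
  proof -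
    have "(\<Sum>j\<in>pverts G. A i j * f j) = (\<Sum>j\<in>pverts G. if j \<in> N i then f j else 0)
        - (\<Sum>j\<in>pverts G. if j = i then card (N i) * f j else 0)"
      unfolding sum_subtractf[symmetric] using that
          by (intro sum.cong) (auto simp: A_def left_diff_distrib)
    also have "(\<Sum>j\<in>pverts G. if j \<in> N i then f j else 0) = (\<Sum>j\<in>N i. f j)"
      using neighbor_in_verts by (intro sum.mono_neutral_cong_right pair_finite_verts) auto
    finally show ?thesis
      using that pair_finite_verts by (simp add: laplacian_def sum_subtractf)
  qed
  have "((\<lambda>s. \<phi> s u) has_real_derivative 0) (at s)" for s
    using \<phi>'[OF u, of s] by (simp add: A_def)
  then have "\<phi> s u = 0" for s
    using DERIV_isconst_all[of "\<lambda>s. \<phi> s u" s 0] \<phi>0[OF u] c by simp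
  then have "dirichlet_flow u \<phi>"
    unfolding dirichlet_flow_def using \<phi>' A by auto metis
  then show ?thesis using that \<phi>0 by blast
qed

text \<open>The parent contributes +1 and every other neighbor -1, giving 2 minus the degree; at
  \<open>r\<close> there is no parent. Acyclicity enters the variance through this count.\<close>

lemma laplacian_hops:
  assumes "r \<in> pverts G" "j \<in> pverts G"
  shows "laplacian G (\<lambda>k. real (d r k)) j = (if j = r then 0 else 2) - real (card (N j))"
proof (cases "j = r")
  case True
  then show ?thesis using hops_neighbor[of _ r] by (simp add: laplacian_def sum_negf)
next
  case False
  obtain p where p: "p \<in> N j" "Suc (d r p) = d r j"
    using ex_closer_neighbor[OF assms False] by auto
  have "real (d r j) - real (d r k) = (if k = p then 2 else 0) - 1" if k: "k \<in> N j" for k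
  proof (cases "k = p")
    case True
    then show ?thesis using p(2)[symmetric] by simp
  next
    case False
    then have "d r k = Suc (d r j)"
      using closer_neighbor_unique[OF assms(1) k p(1)] p(2) hops_neighbor_le(1)[OF assms(1) k]
          by linarith
    then show ?thesis using False by simp
  qed
  then have "laplacian G (\<lambda>k. real (d r k)) j = (\<Sum>k\<in>N j. (if k = p then 2 else 0) - 1)"
    unfolding laplacian_def by (intro sum.cong) auto
  then show ?thesis using False p(1) finite_neighbors by (simp add: sum_subtractf)
qed

lemma laplacian_half_combination:
  "laplacian G (\<lambda>k. (f k + g k - h k) / 2) j = (laplacian G f j + laplacian G g j
      - laplacian G h j) / 2"
  unfolding laplacian_def sum.distrib[symmetric] sum_subtractf[symmetric] sum_divide_distrib
  by (intro sum.cong) (auto simp: field_simps)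

lemma laplacian_const: "laplacian G (\<lambda>_. a) j = 0"
  by (simp add: laplacian_def)

lemma heat_kernel:
  assumes u: "u \<in> pverts G" and i: "i \<in> pverts G" "i \<noteq> u"
  obtains \<phi> H where "dirichlet_flow u \<phi>" "\<And>j. j \<in> pverts G \<Longrightarrow> \<phi> 0 j = (if j = i then 1 else 0)"
    "\<And>s. (H has_real_derivative (\<Sum>j\<in>pverts G - {u}. (\<phi> s j)\<^sup>2)) (at s)" "H 0 = 0"
    "(H \<longlongrightarrow> real (d u i) / 2) at_top"
    "\<And>j. j \<in> pverts G \<Longrightarrow> ((\<lambda>s. \<phi> s j) \<longlongrightarrow> 0) at_top"
proof -
  \<comment> \<open>the column \<open>i\<close> of the inverse of the Dirichlet Laplacian: the number of edges shared
      by the paths from \<open>u\<close> to \<open>i\<close> and to \<open>j\<close>\<close>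
  define q where "q j = (real (d u j) + real (d u i) - real (d i j)) / 2" for j
  have q: "laplacian G q j = (if j = i then 1 else 0)" if "j \<in> pverts G - {u}" for j
    using that i u unfolding q_def laplacian_half_combination
        by (simp add: laplacian_hops laplacian_const)
  have qu: "q u = 0" by (simp add: q_def hops_sym[of i])
  obtain \<psi> where \<psi>: "dirichlet_flow u \<psi>" "\<And>j. j \<in> pverts G \<Longrightarrow> \<psi> 0 j = q j"
    using ex_dirichlet_flow[of u q] u qu by metis
  \<comment> \<open>Up to sign the time derivative of \<psi>. Differentiation in time commutes with
    the Laplacian, so it is again a flow, and it starts at the Laplacian of \<open>q\<close>, the
    unit vector at \<open>i\<close>.\<close>
  define \<phi> where "\<phi> s j = (if j = u then 0 else laplacian G (\<psi> s) j)" for s j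
  have \<psi>': "((\<lambda>s. \<psi> s j) has_real_derivative - \<phi> s j) (at s)" if "j \<in> pverts G" for j s
    using \<psi>(1) that by (cases "j = u") (auto simp: dirichlet_flow_def \<phi>_def)
  have "((\<lambda>s. laplacian G (\<psi> s) j) has_real_derivative - laplacian G (\<phi> s) j) (at s)"
    if "j \<in> pverts G" for j s
    unfolding laplacian_def sum_negf[symmetric]
  proof (rule DERIV_sum)
    fix k assume "k \<in> N j"
    then have "((\<lambda>s. \<psi> s j - \<psi> s k) has_real_derivative (- \<phi> s j) - (- \<phi> s k)) (at s)"
      using that neighbor_in_verts by (intro DERIV_diff \<psi>') auto
    then show "((\<lambda>s. \<psi> s j - \<psi> s k) has_real_derivative - (\<phi> s j - \<phi> s k)) (at s)" by simp
  qed
  moreover have \<phi>_eq: "(\<lambda>s. \<phi> s j) = (\<lambda>s. laplacian G (\<psi> s) j)" if "j \<noteq> u" for j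
    using that by (simp add: \<phi>_def)
  ultimately have \<phi>: "dirichlet_flow u \<phi>"
    using \<phi>_eq by (simp add: dirichlet_flow_def \<phi>_def[of _ u])
  have \<phi>0: "\<phi> 0 j = (if j = i then 1 else 0)" if "j \<in> pverts G" for j
  proof -
    have "laplacian G (\<psi> 0) j = laplacian G q j"
      unfolding laplacian_def using that \<psi>(2) neighbor_in_verts by (intro sum.cong) auto
    then show ?thesis using that q i by (auto simp: \<phi>_def)
  qed
  \<comment> \<open>An explicit antiderivative of the energy of \<phi>: the pairing starts at
    \<open>q i\<close>, which is \<open>d u i\<close>, has derivative minus twice the energy, and
    tends to 0.\<close>
  define H where "H s = (real (d u i) - (\<Sum>j\<in>pverts G. \<phi> s j * \<psi> s j)) / 2" for s
  have "(H has_real_derivative (\<Sum>j\<in>pverts G - {u}. (\<phi> s j)\<^sup>2)) (at s)" for s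
  proof -
    have "(H has_real_derivative (0
        - (- 2 * (\<Sum>j\<in>pverts G. \<phi> s j * laplacian G (\<psi> s) j))) / 2) (at s)"
      unfolding H_def by (intro DERIV_cdivide DERIV_diff DERIV_const dirichlet_flow_inner[OF u \<phi>
          \<psi>(1)])
    moreover have "(\<Sum>j\<in>pverts G. \<phi> s j * laplacian G (\<psi> s) j) = (\<Sum>j\<in>pverts G - {u}. (\<phi> s j)\<^sup>2)"
      using u pair_finite_verts by (subst sum.remove[of _ u]) (auto simp: \<phi>_def power2_eq_square)
    ultimately show ?thesis by simp
  qed
  moreover have "H 0 = 0"
  proof -
    have "(\<Sum>j\<in>pverts G. \<phi> 0 j * \<psi> 0 j) = (\<Sum>j\<in>pverts G. if j = i then q j else 0)"
      using \<phi>0 \<psi>(2) by (intro sum.cong) auto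
    then show ?thesis using i pair_finite_verts by (simp add: H_def q_def)
  qed
  moreover have "(H \<longlongrightarrow> real (d u i) / 2) at_top"
  proof -
    have "((\<lambda>s. \<Sum>j\<in>pverts G. \<phi> s j * \<psi> s j) \<longlongrightarrow> 0) at_top"
    proof (rule Lim_null_comparison)
      show "((\<lambda>s. (\<Sum>j\<in>pverts G. (\<phi> s j)\<^sup>2) + (\<Sum>j\<in>pverts G. (\<psi> s j)\<^sup>2)) \<longlongrightarrow> 0) at_top"
        using tendsto_add[OF dirichlet_flow_decay[OF u \<phi>] dirichlet_flow_decay[OF u \<psi>(1)]] by simp
      show "\<forall>\<^sub>F s in at_top. norm (\<Sum>j\<in>pverts G. \<phi> s j * \<psi> s j)
          \<le> (\<Sum>j\<in>pverts G. (\<phi> s j)\<^sup>2) + (\<Sum>j\<in>pverts G. (\<psi> s j)\<^sup>2)"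
      proof (intro always_eventually allI)
        fix s
        have "\<bar>a * b\<bar> \<le> a\<^sup>2 + b\<^sup>2" for a b :: real
          using sum_squares_bound[of a b] sum_squares_bound[of a "-b"] zero_le_power2[of a]
              zero_le_power2[of b]
          by (auto simp: abs_le_iff)
        then show "norm (\<Sum>j\<in>pverts G. \<phi> s j * \<psi> s j)
          \<le> (\<Sum>j\<in>pverts G. (\<phi> s j)\<^sup>2) + (\<Sum>j\<in>pverts G. (\<psi> s j)\<^sup>2)"
          unfolding sum.distrib[symmetric] real_norm_def by (intro order_trans[OF sum_abs] sum_mono)
      qed
    qed
    then have "(H \<longlongrightarrow> (real (d u i) - 0) / 2) at_top"
      unfolding H_def[abs_def] by (intro tendsto_intros) auto
    then show ?thesis by simp
  qed
  moreover have "((\<lambda>s. \<phi> s j) \<longlongrightarrow> 0) at_top" if "j \<in> pverts G" for j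
  proof (rule Lim_null_comparison)
    show "((\<lambda>s. sqrt (\<Sum>i\<in>pverts G. (\<phi> s i)\<^sup>2)) \<longlongrightarrow> 0) at_top"
      using tendsto_real_sqrt[OF dirichlet_flow_decay[OF u \<phi>]] by simp
    show "\<forall>\<^sub>F s in at_top. norm (\<phi> s j) \<le> sqrt (\<Sum>i\<in>pverts G. (\<phi> s i)\<^sup>2)"
    proof (intro always_eventually allI)
      fix s
      have "(\<phi> s j)\<^sup>2 \<le> (\<Sum>i\<in>pverts G. (\<phi> s i)\<^sup>2)"
        using member_le_sum[OF that _ pair_finite_verts, of "\<lambda>i. (\<phi> s i)\<^sup>2"] by simp
      then show "norm (\<phi> s j) \<le> sqrt (\<Sum>i\<in>pverts G. (\<phi> s i)\<^sup>2)" by (simp add: real_le_rsqrt)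
    qed
  qed
  ultimately show ?thesis using that \<phi> \<phi>0 by blast
qed

end

section \<open>Wiener integrals of smooth functions\<close>

lemma integrable_mult_of_squares:
  fixes X Y :: "'w \<Rightarrow> real"
  assumes "X \<in> borel_measurable M" "Y \<in> borel_measurable M"
    and "integrable M (\<lambda>\<omega>. (X \<omega>)\<^sup>2)" "integrable M (\<lambda>\<omega>. (Y \<omega>)\<^sup>2)"
  shows "integrable M (\<lambda>\<omega>. X \<omega> * Y \<omega>)"
proof (rule Bochner_Integration.integrable_bound)
  show "integrable M (\<lambda>\<omega>. (X \<omega>)\<^sup>2 + (Y \<omega>)\<^sup>2)" using assms by simp
  have "\<bar>a * b\<bar> \<le> a\<^sup>2 + b\<^sup>2" for a b :: real
    using sum_squares_bound[of a b] sum_squares_bound[of a "-b"] zero_le_power2[of a]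
        zero_le_power2[of b]
    by (auto simp: abs_le_iff)
  then show "AE \<omega> in M. norm (X \<omega> * Y \<omega>) \<le> norm ((X \<omega>)\<^sup>2 + (Y \<omega>)\<^sup>2)" by simp
qed (use assms in measurable)

lemma integrable_square_add:
  fixes X Y :: "'w \<Rightarrow> real"
  assumes "X \<in> borel_measurable M" "Y \<in> borel_measurable M"
    and "integrable M (\<lambda>\<omega>. (X \<omega>)\<^sup>2)" "integrable M (\<lambda>\<omega>. (Y \<omega>)\<^sup>2)"
  shows "integrable M (\<lambda>\<omega>. (X \<omega> + Y \<omega>)\<^sup>2)"
  using assms integrable_mult_of_squares[OF assms] by (simp add: power2_sum mult.assoc)

lemma integral_Cauchy_Schwarz:
  fixes X Y :: "'w \<Rightarrow> real"
  assumes "X \<in> borel_measurable M" "Y \<in> borel_measurable M"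
    and X: "integrable M (\<lambda>\<omega>. (X \<omega>)\<^sup>2)" and Y: "integrable M (\<lambda>\<omega>. (Y \<omega>)\<^sup>2)"
  shows "(\<integral>\<omega>. X \<omega> * Y \<omega> \<partial>M)\<^sup>2 \<le> (\<integral>\<omega>. (X \<omega>)\<^sup>2 \<partial>M) * (\<integral>\<omega>. (Y \<omega>)\<^sup>2 \<partial>M)"
proof -
  have XY: "integrable M (\<lambda>\<omega>. X \<omega> * Y \<omega>)" by (rule integrable_mult_of_squares[OF assms])
  define a b c where "a = (\<integral>\<omega>. (X \<omega>)\<^sup>2 \<partial>M)" and "b = (\<integral>\<omega>. X \<omega> * Y \<omega> \<partial>M)" and "c = (\<integral>\<omega>. (Y \<omega>)\<^sup>2 \<partial>M)"
  have quad: "0 \<le> a * r\<^sup>2 + 2 * b * (r * s) + c * s\<^sup>2" for r s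
  proof -
    have "0 \<le> (\<integral>\<omega>. (r * X \<omega> + s * Y \<omega>)\<^sup>2 \<partial>M)" by (intro integral_nonneg_AE) auto
    also have "(\<lambda>\<omega>. (r * X \<omega> + s * Y \<omega>)\<^sup>2) = (\<lambda>\<omega>. r\<^sup>2 * (X \<omega>)\<^sup>2 + (2 * (r * s)) * (X \<omega> * Y \<omega>)
        + s\<^sup>2 * (Y \<omega>)\<^sup>2)"
      by (auto simp: power2_eq_square algebra_simps)
    also have "(\<integral>\<omega>. r\<^sup>2 * (X \<omega>)\<^sup>2 + (2 * (r * s)) * (X \<omega> * Y \<omega>) + s\<^sup>2 * (Y \<omega>)\<^sup>2 \<partial>M)
      = r\<^sup>2 * a + (2 * (r * s)) * b + s\<^sup>2 * c"
      using X Y XY by (simp add: a_def b_def c_def)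
    finally show ?thesis by (simp add: mult_ac)
  qed
  have "0 \<le> a" "0 \<le> c" unfolding a_def c_def by (intro integral_nonneg_AE; simp)+
  have "b\<^sup>2 \<le> a * c"
  \<comment> \<open>Discriminant without division: the points \<open>(-b, a)\<close> and
    \<open>(c, -b)\<close> turn the quadratic form into \<open>a\<close> and \<open>c\<close> times
    \<open>a * c - b\<^sup>2\<close>, which is conclusive unless both factors vanish.\<close>
  proof (cases "a = 0 \<and> c = 0")
    case True
    then have "b = 0" using quad[of 1 1] quad[of 1 "-1"] by simp
    then show ?thesis using True by simp
  next
    case False
    have "0 \<le> a * (a * c - b\<^sup>2)"
      using quad[of "-b" a] by (simp add: power2_eq_square algebra_simps)
    moreover have "0 \<le> c * (a * c - b\<^sup>2)"
      using quad[of c "-b"] by (simp add: power2_eq_square algebra_simps)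
    moreover have "0 < a \<or> 0 < c" using False \<open>0 \<le> a\<close> \<open>0 \<le> c\<close> by auto
    ultimately show ?thesis by (auto simp: zero_le_mult_iff)
  qed
  then show ?thesis by (simp add: a_def b_def c_def)
qed

text \<open>\<open>X\<close> and \<open>Y\<close> may be correlated in any way: by Cauchy-Schwarz
  the mixed term is at most the root of a bounded factor times a vanishing one.\<close>

lemma second_moment_perturb:
  fixes X Y :: "'b \<Rightarrow> 'w \<Rightarrow> real"
  assumes "\<And>n. X n \<in> borel_measurable M" "\<And>n. Y n \<in> borel_measurable M"
    and X: "\<forall>\<^sub>F n in F. integrable M (\<lambda>\<omega>. (X n \<omega>)\<^sup>2)"
        and Y: "\<forall>\<^sub>F n in F. integrable M (\<lambda>\<omega>. (Y n \<omega>)\<^sup>2)"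
    and X_lim: "((\<lambda>n. \<integral>\<omega>. (X n \<omega>)\<^sup>2 \<partial>M) \<longlongrightarrow> L) F" and Y_lim: "((\<lambda>n. \<integral>\<omega>. (Y n \<omega>)\<^sup>2 \<partial>M) \<longlongrightarrow> 0) F"
  shows "((\<lambda>n. \<integral>\<omega>. (X n \<omega> + Y n \<omega>)\<^sup>2 \<partial>M) \<longlongrightarrow> L) F"
proof -
  let ?x = "\<lambda>n. \<integral>\<omega>. (X n \<omega>)\<^sup>2 \<partial>M" and ?y = "\<lambda>n. \<integral>\<omega>. (Y n \<omega>)\<^sup>2 \<partial>M"
    and ?xy = "\<lambda>n. \<integral>\<omega>. X n \<omega> * Y n \<omega> \<partial>M"
  have "(?xy \<longlongrightarrow> 0) F"
  proof (rule Lim_null_comparison)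
    show "((\<lambda>n. sqrt (?x n * ?y n)) \<longlongrightarrow> 0) F"
      using tendsto_real_sqrt[OF tendsto_mult[OF X_lim Y_lim]] by simp
    show "\<forall>\<^sub>F n in F. norm (?xy n) \<le> sqrt (?x n * ?y n)"
      using X Y
    proof eventually_elim
      case (elim n)
      show ?case
        using integral_Cauchy_Schwarz[OF assms(1,2) elim] by (simp add: real_le_rsqrt)
    qed
  qed
  then have "((\<lambda>n. ?x n + 2 * ?xy n + ?y n) \<longlongrightarrow> L + 2 * 0 + 0) F"
    by (intro tendsto_intros X_lim Y_lim)
  moreover have "\<forall>\<^sub>F n in F. ?x n + 2 * ?xy n + ?y n = (\<integral>\<omega>. (X n \<omega> + Y n \<omega>)\<^sup>2 \<partial>M)"
    using X Y
  proof eventually_elim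
    case (elim n)
    have "(\<integral>\<omega>. (X n \<omega> + Y n \<omega>)\<^sup>2 \<partial>M) = (\<integral>\<omega>. (X n \<omega>)\<^sup>2 + 2 * (X n \<omega> * Y n \<omega>) + (Y n \<omega>)\<^sup>2 \<partial>M)"
      by (intro Bochner_Integration.integral_cong) (auto simp: power2_eq_square algebra_simps)
    then show ?case
      using elim integrable_mult_of_squares[OF assms(1,2) elim] by simp
  qed
  ultimately show ?thesis by (simp add: tendsto_cong)
qed

text \<open>Fatou's lemma, applied as \<open>m\<close> grows, turns the Cauchy bound into an L2
  distance to the almost sure limit. That limit is thus also the L2 limit and inherits the second
  moment.\<close>

lemma L2_Cauchy_limit:
  fixes S :: "nat \<Rightarrow> 'w \<Rightarrow> real"
  assumes S [measurable]: "\<And>n. S n \<in> borel_measurable M"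
      and D [measurable]: "D \<in> borel_measurable M"
    and int: "\<And>n. integrable M (\<lambda>\<omega>. (S n \<omega>)\<^sup>2)"
    and lim: "AE \<omega> in M. (\<lambda>n. S n \<omega>) \<longlonglongrightarrow> D \<omega>"
    and Cauchy: "\<And>n m. n \<le> m \<Longrightarrow> (\<integral>\<omega>. (S n \<omega> - S m \<omega>)\<^sup>2 \<partial>M) \<le> \<epsilon> n"
    and \<epsilon>: "\<epsilon> \<longlonglongrightarrow> 0"
    and L: "(\<lambda>n. \<integral>\<omega>. (S n \<omega>)\<^sup>2 \<partial>M) \<longlonglongrightarrow> L"
  shows "integrable M (\<lambda>\<omega>. (D \<omega>)\<^sup>2)" "(\<integral>\<omega>. (D \<omega>)\<^sup>2 \<partial>M) = L"
proof -
  have int_diff: "integrable M (\<lambda>\<omega>. (S n \<omega> - S m \<omega>)\<^sup>2)" for n m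
    using integrable_square_add[of "S n" M "\<lambda>\<omega>. - S m \<omega>"] int by simp
  have \<epsilon>_nonneg: "0 \<le> \<epsilon> n" for n using Cauchy[of n n] by simp
  have bound: "(\<integral>\<^sup>+\<omega>. ennreal ((S n \<omega> - D \<omega>)\<^sup>2) \<partial>M) \<le> ennreal (\<epsilon> n)" for n
  proof -
    have "(\<integral>\<^sup>+\<omega>. ennreal ((S n \<omega> - D \<omega>)\<^sup>2) \<partial>M) = (\<integral>\<^sup>+\<omega>. liminf (\<lambda>m. ennreal ((S n \<omega>
        - S m \<omega>)\<^sup>2)) \<partial>M)"
    proof (rule nn_integral_cong_AE)
      show "AE \<omega> in M. ennreal ((S n \<omega> - D \<omega>)\<^sup>2) = liminf (\<lambda>m. ennreal ((S n \<omega> - S m \<omega>)\<^sup>2))"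
        using lim
      proof eventually_elim
        case (elim \<omega>)
        then have "(\<lambda>m. ennreal ((S n \<omega> - S m \<omega>)\<^sup>2)) \<longlonglongrightarrow> ennreal ((S n \<omega> - D \<omega>)\<^sup>2)"
          by (intro tendsto_intros)
        then show ?case by (intro lim_imp_Liminf[symmetric]) auto
      qed
    qed
    also have "\<dots> \<le> liminf (\<lambda>m. \<integral>\<^sup>+\<omega>. ennreal ((S n \<omega> - S m \<omega>)\<^sup>2) \<partial>M)"
      by (rule nn_integral_liminf) measurable
    also have "\<dots> \<le> ennreal (\<epsilon> n)"
    proof -
      have "\<forall>\<^sub>F m in sequentially. (\<integral>\<^sup>+\<omega>. ennreal ((S n \<omega> - S m \<omega>)\<^sup>2) \<partial>M) \<le> ennreal (\<epsilon> n)"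
        using eventually_ge_at_top[of n]
        by eventually_elim (simp add: nn_integral_eq_integral int_diff Cauchy ennreal_leI)
      then show ?thesis by (intro Liminf_le) auto
    qed
    finally show ?thesis .
  qed
  have int_D: "integrable M (\<lambda>\<omega>. (D \<omega> - S n \<omega>)\<^sup>2)" for n
    using bound[of n] by (intro integrableI_bounded) (auto simp: power2_commute[of "S n _"] intro:
        le_less_trans)
  have le_D: "(\<integral>\<omega>. (D \<omega> - S n \<omega>)\<^sup>2 \<partial>M) \<le> \<epsilon> n" for n
  proof -
    have "ennreal (\<integral>\<omega>. (D \<omega> - S n \<omega>)\<^sup>2 \<partial>M) \<le> ennreal (\<epsilon> n)"
      using bound[of n] int_D[of n] by (simp add: nn_integral_eq_integral power2_commute[of "S n
          _"])
    then show ?thesis using \<epsilon>_nonneg by simp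
  qed
  have D_lim: "(\<lambda>n. \<integral>\<omega>. (D \<omega> - S n \<omega>)\<^sup>2 \<partial>M) \<longlonglongrightarrow> 0"
    using le_D by (intro tendsto_sandwich[OF _ _ tendsto_const \<epsilon>]) (auto intro!: always_eventually
        integral_nonneg_AE)
  show "integrable M (\<lambda>\<omega>. (D \<omega>)\<^sup>2)"
    using integrable_square_add[of "S 0" M "\<lambda>\<omega>. D \<omega> - S 0 \<omega>"] int int_D by simp
  have "(\<lambda>n. \<integral>\<omega>. (S n \<omega> + (D \<omega> - S n \<omega>))\<^sup>2 \<partial>M) \<longlonglongrightarrow> L"
    using int int_D by (intro second_moment_perturb L D_lim) auto
  then show "(\<integral>\<omega>. (D \<omega>)\<^sup>2 \<partial>M) = L"
    by (simp add: LIMSEQ_const_iff)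
qed

lemma second_moment_orthogonal_sum:
  fixes X :: "'b \<Rightarrow> 'w \<Rightarrow> real"
  assumes "finite I" and [measurable]: "\<And>p. p \<in> I \<Longrightarrow> X p \<in> borel_measurable M"
    and int: "\<And>p. p \<in> I \<Longrightarrow> integrable M (\<lambda>\<omega>. (X p \<omega>)\<^sup>2)"
    and square: "\<And>p. p \<in> I \<Longrightarrow> (\<integral>\<omega>. (X p \<omega>)\<^sup>2 \<partial>M) = h"
    and ortho: "\<And>p q. p \<in> I \<Longrightarrow> q \<in> I \<Longrightarrow> p \<noteq> q \<Longrightarrow> (\<integral>\<omega>. X p \<omega> * X q \<omega> \<partial>M) = 0"
  shows "integrable M (\<lambda>\<omega>. (\<Sum>p\<in>I. f p * X p \<omega>)\<^sup>2)"
    and "(\<integral>\<omega>. (\<Sum>p\<in>I. f p * X p \<omega>)\<^sup>2 \<partial>M) = (\<Sum>p\<in>I. (f p)\<^sup>2 * h)"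
proof -
  have int2: "integrable M (\<lambda>\<omega>. X p \<omega> * X q \<omega>)" if "p \<in> I" "q \<in> I" for p q
    using that int by (intro integrable_mult_of_squares) auto
  have eq: "(\<Sum>p\<in>I. f p * X p \<omega>)\<^sup>2 = (\<Sum>p\<in>I. \<Sum>q\<in>I. (f p * f q) * (X p \<omega> * X q \<omega>))" for \<omega>
    by (simp add: power2_eq_square sum_product mult_ac)
  show "integrable M (\<lambda>\<omega>. (\<Sum>p\<in>I. f p * X p \<omega>)\<^sup>2)"
    unfolding eq using int2 by (intro Bochner_Integration.integrable_sum integrable_mult_right) auto
  have "(\<integral>\<omega>. (\<Sum>p\<in>I. f p * X p \<omega>)\<^sup>2 \<partial>M) = (\<Sum>p\<in>I. \<Sum>q\<in>I. (f p * f q) * (\<integral>\<omega>. X p \<omega> * X q \<omega> \<partial>M))"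
    unfolding eq using int2
    by (subst Bochner_Integration.integral_sum, force intro!: Bochner_Integration.integrable_sum)
      (intro sum.cong refl, subst Bochner_Integration.integral_sum, auto)
  also have "\<dots> = (\<Sum>p\<in>I. \<Sum>q\<in>I. if q = p then (f p)\<^sup>2 * h else 0)"
    using ortho square by (intro sum.cong refl) (auto simp: power2_eq_square)
  also have "\<dots> = (\<Sum>p\<in>I. (f p)\<^sup>2 * h)" using assms(1) by simp
  finally show "(\<integral>\<omega>. (\<Sum>p\<in>I. f p * X p \<omega>)\<^sup>2 \<partial>M) = (\<Sum>p\<in>I. (f p)\<^sup>2 * h)" .
qed

section \<open>Orthogonality of Wiener increments and the discrete Ito isometry\<close>

context prob_space begin

lemma expectation_mult_indep:
  assumes "indep_vars (\<lambda>_. borel) X I" "i \<in> I" "j \<in> I" "i \<noteq> j"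
    and "integrable M (X i)" "integrable M (X j)"
  shows "expectation (\<lambda>\<omega>. X i \<omega> * X j \<omega> :: real) = expectation (X i) * expectation (X j)"
proof -
  have "indep_vars (\<lambda>_. borel) X {i, j}"
    using assms by (intro indep_vars_subset[OF assms(1)]) auto
  then have "expectation (\<lambda>\<omega>. \<Prod>k\<in>{i, j}. X k \<omega>) = (\<Prod>k\<in>{i, j}. expectation (X k))"
    using assms by (intro indep_vars_lebesgue_integral) auto
  then show ?thesis using assms(4) by simp
qed

lemma wiener_increment:
  assumes "wiener_process M B" "0 \<le> s" "s < t"
  shows "integrable M (\<lambda>\<omega>. B t \<omega> - B s \<omega>)" "expectation (\<lambda>\<omega>. B t \<omega> - B s \<omega>) = 0"
    "integrable M (\<lambda>\<omega>. (B t \<omega> - B s \<omega>)\<^sup>2)" "expectation (\<lambda>\<omega>. (B t \<omega> - B s \<omega>)\<^sup>2) = t - s"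
proof -
  have \<sigma>: "0 < sqrt (t - s)" using assms by simp
  have D: "distributed M lborel (\<lambda>\<omega>. B t \<omega> - B s \<omega>) (\<lambda>x. ennreal (normal_density 0 (sqrt (t
      - s)) x))"
    using assms unfolding wiener_process_def by blast
  show "integrable M (\<lambda>\<omega>. B t \<omega> - B s \<omega>)"
    using integrable_normal_moment[OF \<sigma>, of 0 1] D
    by (intro distributed_integrable_var[OF D]) auto
  show E: "expectation (\<lambda>\<omega>. B t \<omega> - B s \<omega>) = 0"
    by (rule normal_distributed_expectation[OF \<sigma> D])
  show "integrable M (\<lambda>\<omega>. (B t \<omega> - B s \<omega>)\<^sup>2)"
    using integrable_normal_moment[OF \<sigma>, of 0 2] distributed_integrable[OF D, of "\<lambda>x. x\<^sup>2"] by simp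
  show "expectation (\<lambda>\<omega>. (B t \<omega> - B s \<omega>)\<^sup>2) = t - s"
    using normal_distributed_variance[OF \<sigma> D] assms unfolding E by simp
qed

text \<open>An increment is a measurable function of the whole path through two of its coordinates,
  so independence of paths passes to increments over unrelated time intervals.\<close>

lemma independent_wiener_increments:
  assumes W: "independent_wiener_processes M I W" and ij: "i \<in> I" "j \<in> I" "i \<noteq> j"
    and "0 \<le> s" "s < t" "0 \<le> s'" "s' < t'"
  shows "expectation (\<lambda>\<omega>. (W i t \<omega> - W i s \<omega>) * (W j t' \<omega> - W j s' \<omega>)) = 0"
proof -
  define Y where "Y k f = (if k = i then f t - f s else f t' - f s')" for k and f :: "real \<Rightarrow> real"
  have "indep_vars (\<lambda>_. borel) (\<lambda>k \<omega>. Y k (\<lambda>r\<in>{0..}. W k r \<omega>)) I"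
  proof (rule indep_vars_compose2[where Y = Y and X = "\<lambda>k \<omega>. \<lambda>r\<in>{0..}. W k r \<omega>"])
    show "indep_vars (\<lambda>_. Pi\<^sub>M {0..} (\<lambda>_. borel)) (\<lambda>i \<omega>. \<lambda>t\<in>{0..}. W i t \<omega>) I"
      using W unfolding independent_wiener_processes_def by simp
    show "Y k \<in> Pi\<^sub>M {0..} (\<lambda>_. borel) \<rightarrow>\<^sub>M borel" for k
      unfolding Y_def using assms
      by (cases "k = i") (auto intro!: borel_measurable_diff measurable_component_singleton)
  qed
  moreover have Y: "(\<lambda>\<omega>. Y i (\<lambda>r\<in>{0..}. W i r \<omega>)) = (\<lambda>\<omega>. W i t \<omega> - W i s \<omega>)"
    "(\<lambda>\<omega>. Y j (\<lambda>r\<in>{0..}. W j r \<omega>)) = (\<lambda>\<omega>. W j t' \<omega> - W j s' \<omega>)"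
    using assms by (auto simp: Y_def)
  moreover have "wiener_process M (W i)" "wiener_process M (W j)"
    using W ij by (auto simp: independent_wiener_processes_def)
  ultimately show ?thesis
    using expectation_mult_indep[of "\<lambda>k \<omega>. Y k (\<lambda>r\<in>{0..}. W k r \<omega>)" I i j] ij
      wiener_increment(1,2)[of "W i" s t] wiener_increment(1,2)[of "W j" s' t'] assms(5-)
    by (simp add: fun_eq_iff)
qed

lemma disjoint_wiener_increments:
  assumes B: "wiener_process M B" and h: "0 < h" and kl: "k \<noteq> l"
  shows "expectation (\<lambda>\<omega>. (B (real (Suc k) * h) \<omega> - B (real k * h) \<omega>) * (B (real (Suc l) * h) \<omega>
      - B (real l * h) \<omega>)) = 0"
proof -
  define n where "n = Suc (max k l)"
  have ind: "indep_vars (\<lambda>_. borel) (\<lambda>k \<omega>. B (real (Suc k) * h) \<omega> - B (real k * h) \<omega>) {..<n}"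
    using B h unfolding wiener_process_def
        by (elim conjE allE[of _ n] allE[of _ "\<lambda>k. real k * h"]) auto
  have "real k * h < real (Suc k) * h" for k using h by simp
  then show ?thesis
    using expectation_mult_indep[OF ind, of k l] kl wiener_increment(1,2)[OF B] h
    by (simp add: n_def del: of_nat_Suc)
qed

text \<open>The Ito isometry for deterministic step functions: increments of different processes or
  over different grid intervals are uncorrelated.\<close>

lemma wiener_sum_second_moment:
  fixes f :: "'i \<Rightarrow> nat \<Rightarrow> real" and n :: nat
  assumes W: "independent_wiener_processes M I W" and I: "finite I" and h: "0 < h"
  defines "S \<equiv> \<lambda>\<omega>. \<Sum>i\<in>I. \<Sum>k<n. f i k * (W i (real (Suc k) * h) \<omega> - W i (real k * h) \<omega>)"
  shows "integrable M (\<lambda>\<omega>. (S \<omega>)\<^sup>2)" "expectation (\<lambda>\<omega>. (S \<omega>)\<^sup>2) = (\<Sum>i\<in>I. \<Sum>k<n. (f i k)\<^sup>2 * h)"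
proof -
  define X where "X p \<omega> = W (fst p) (real (Suc (snd p)) * h) \<omega> - W (fst p) (real (snd p) * h) \<omega>"
    for p :: "'i \<times> nat" and \<omega>
  have B: "wiener_process M (W i)" if "i \<in> I" for i
    using W that by (auto simp: independent_wiener_processes_def)
  have less: "real k * h < real (Suc k) * h" "0 \<le> real k * h" for k using h by simp_all
  have meas: "X p \<in> borel_measurable M" if "p \<in> I \<times> {..<n}" for p
  proof -
    have "W (fst p) (real k * h) \<in> borel_measurable M" for k :: nat
      using B[of "fst p"] that h unfolding wiener_process_def by force
    then show ?thesis unfolding X_def by (intro borel_measurable_diff)
  qed
  have int: "integrable M (\<lambda>\<omega>. (X p \<omega>)\<^sup>2)" "expectation (\<lambda>\<omega>. (X p \<omega>)\<^sup>2) = h" if "p \<in> I \<times> {..<n}"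
      for p
  proof -
    have "wiener_process M (W (fst p))" using that B by auto
    note * = wiener_increment(3,4)[OF this less(2) less(1), of "snd p"]
    show "integrable M (\<lambda>\<omega>. (X p \<omega>)\<^sup>2)" unfolding X_def by (rule *(1))
    show "expectation (\<lambda>\<omega>. (X p \<omega>)\<^sup>2) = h" unfolding X_def *(2) by (simp add: algebra_simps)
  qed
  have ortho: "expectation (\<lambda>\<omega>. X p \<omega> * X q \<omega>) = 0" if "p \<in> I \<times> {..<n}" "q \<in> I \<times> {..<n}" "p \<noteq> q"
      for p q
  proof (cases "fst p = fst q")
    case True
    then have "snd p \<noteq> snd q" using that by (simp add: prod_eq_iff)
    moreover have "wiener_process M (W (fst q))" using that B by auto
    ultimately show ?thesis
      unfolding X_def True using disjoint_wiener_increments h by blast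
  next
    case False
    moreover have "fst p \<in> I" "fst q \<in> I" using that by auto
    ultimately show ?thesis
      unfolding X_def using independent_wiener_increments[OF W] less by blast
  qed
  have S: "S \<omega> = (\<Sum>p\<in>I \<times> {..<n}. case_prod f p * X p \<omega>)" for \<omega>
    unfolding S_def X_def sum.cartesian_product by (intro sum.cong) auto
  have fin: "finite (I \<times> {..<n})" using I by simp
  show "integrable M (\<lambda>\<omega>. (S \<omega>)\<^sup>2)"
    unfolding S by (rule second_moment_orthogonal_sum(1)[OF fin meas int ortho])
  have "expectation (\<lambda>\<omega>. (S \<omega>)\<^sup>2) = (\<Sum>p\<in>I \<times> {..<n}. (case_prod f p)\<^sup>2 * h)"
    unfolding S by (rule second_moment_orthogonal_sum(2)[OF fin meas int ortho])
  then show "expectation (\<lambda>\<omega>. (S \<omega>)\<^sup>2) = (\<Sum>i\<in>I. \<Sum>k<n. (f i k)\<^sup>2 * h)"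
    unfolding sum.cartesian_product by (simp add: case_prod_unfold)
qed

end

text \<open>
  The offset \<open>e\<close> selects left (\<open>0\<close>) or right (\<open>1\<close>) endpoints as evaluation points.
\<close>

lemma stieltjes_sums:
  fixes b f f' :: "'i \<Rightarrow> real \<Rightarrow> real" and e :: nat
  assumes t: "0 < t" and I: "finite I" and e: "e \<le> 1"
    and b: "\<And>i. i \<in> I \<Longrightarrow> continuous_on {0..t} (b i)"
    and f: "\<And>i s. i \<in> I \<Longrightarrow> s \<in> {0..t} \<Longrightarrow> (f i has_real_derivative f' i s) (at s within {0..t})"
    and C: "\<And>i s. i \<in> I \<Longrightarrow> s \<in> {0..t} \<Longrightarrow> \<bar>f' i s\<bar> \<le> C"
    and J: "\<And>s. s \<in> {0..t} \<Longrightarrow> (J has_real_derivative (\<Sum>i\<in>I. f' i s * b i s)) (at s within {0..t})"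
  shows "(\<lambda>n. \<Sum>i\<in>I. \<Sum>k<n. b i (real (k + e) * (t / n)) * (f i (real (Suc k) * (t / n))
      - f i (real k * (t / n))))
           \<longlonglongrightarrow> J t - J 0"
proof (rule LIMSEQ_I)
  fix r :: real assume r: "0 < r"
  \<comment> \<open>The local errors below add up to
    \<open>card I * \<bar>C\<bar> * t * \<epsilon>\<close>; \<open>K\<close> strictly exceeds the
    factor of \<epsilon> and is positive even when \<open>I\<close> is empty.\<close>
  define K where "K = real (card I) * (\<bar>C\<bar> + 1) * t + 1"
  have K: "0 < K" unfolding K_def using t by (intro add_nonneg_pos mult_nonneg_nonneg) auto
  define \<epsilon> where "\<epsilon> = r / K"
  have \<epsilon>: "0 < \<epsilon>" using r K by (simp add: \<epsilon>_def)
  have "\<exists>\<delta>>0. \<forall>x\<in>{0..t}. \<forall>y\<in>{0..t}. dist y x < \<delta> \<longrightarrow> dist (b i y) (b i x) < \<epsilon>" if "i \<in> I" for i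
    using compact_uniformly_continuous[OF b[OF that]] \<epsilon> unfolding uniformly_continuous_on_def
        by auto
  then obtain \<delta>' where \<delta>': "\<And>i. i \<in> I \<Longrightarrow> 0 < \<delta>' i"
    "\<And>i x y. i \<in> I \<Longrightarrow> x \<in> {0..t} \<Longrightarrow> y \<in> {0..t} \<Longrightarrow> dist y x < \<delta>' i \<Longrightarrow> dist (b i y) (b i x) < \<epsilon>"
    by metis
  define \<delta> where "\<delta> = Min (insert 1 (\<delta>' ` I))"
  have \<delta>: "0 < \<delta>" "\<And>i. i \<in> I \<Longrightarrow> \<delta> \<le> \<delta>' i" unfolding \<delta>_def using I \<delta>'(1) by auto
  obtain n0 :: nat where n0: "t / \<delta> < n0" using reals_Archimedean2 by blast
  have "norm ((\<Sum>i\<in>I. \<Sum>k<n. b i (real (k + e) * (t / n)) * (f i (real (Suc k) * (t / n))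
      - f i (real k * (t / n))))
       - (J t - J 0)) < r" if n: "n0 \<le> n" for n
  proof -
    have "t / \<delta> < n" using n0 n by linarith
    moreover have "0 < t / \<delta>" using t \<delta> by simp
    ultimately have npos: "0 < real n" by linarith
    define h where "h = t / n"
    have h: "0 < h" "h < \<delta>" "real n * h = t"
      using t npos \<open>t / \<delta> < n\<close> \<delta>(1) by (auto simp: h_def field_simps)
    have step: "\<bar>(\<Sum>i\<in>I. b i (real (k + e) * h) * (f i (real (Suc k) * h) - f i (real k * h)))
        - (J (real (Suc k) * h) - J (real k * h))\<bar> \<le> real (card I) * (\<bar>C\<bar> * \<epsilon>) * h" if k: "k < n"
            for k
    proof -
      \<comment> \<open>On one mesh interval \<open>b\<close> is frozen at the evaluation point. The
        derivative of \<open>g\<close> then contains only the oscillation of \<open>b\<close>, which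
        is below \<epsilon>, and the mean value inequality bounds the local error.\<close>
      define g where "g s = (\<Sum>i\<in>I. b i (real (k + e) * h) * f i s) - J s" for s
      let ?S = "{real k * h..real (Suc k) * h}"
      have le_t: "real (Suc k) * h \<le> t"
        unfolding h(3)[symmetric] using k h(1) by (intro mult_right_mono) auto
      have sub: "?S \<subseteq> {0..t}" using le_t h(1) by auto
      have e_S: "real (k + e) * h \<in> ?S"
        using e h(1) by (cases e) (auto simp: algebra_simps)
      have "norm (g (real (Suc k) * h) - g (real k * h))
          \<le> (real (card I) * (\<bar>C\<bar> * \<epsilon>)) * norm (real (Suc k) * h - real k * h)"
      proof (rule field_differentiable_bound)
        show "convex ?S" by simp
        show "real (Suc k) * h \<in> ?S" "real k * h \<in> ?S" using h(1) by (auto simp: algebra_simps)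
        fix s assume s: "s \<in> ?S"
        show "(g has_real_derivative (\<Sum>i\<in>I. b i (real (k + e) * h) * f' i s)
            - (\<Sum>i\<in>I. f' i s * b i s)) (at s within ?S)"
          unfolding g_def using s sub
          by (intro DERIV_subset[OF _ sub] DERIV_diff DERIV_sum DERIV_cmult f J) auto
        have "(\<Sum>i\<in>I. b i (real (k + e) * h) * f' i s) - (\<Sum>i\<in>I. f' i s * b i s)
            = (\<Sum>i\<in>I. f' i s * (b i (real (k + e) * h) - b i s))"
          unfolding sum_subtractf[symmetric] by (intro sum.cong) (auto simp: algebra_simps)
        moreover have "\<bar>\<dots>\<bar> \<le> (\<Sum>i\<in>I. \<bar>C\<bar> * \<epsilon>)"
        proof (rule order_trans[OF sum_abs], rule sum_mono)
          fix i assume i: "i \<in> I"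
          have "\<bar>real (k + e) * h - s\<bar> \<le> h" using s e_S h(1) e
              by (auto simp: algebra_simps abs_le_iff le_Suc_eq)
          then have "dist (real (k + e) * h) s < \<delta>' i"
            using h(2) \<delta>(2)[OF i] by (simp add: dist_real_def)
          then have "\<bar>b i (real (k + e) * h) - b i s\<bar> < \<epsilon>"
            using \<delta>'(2)[OF i, of s "real (k + e) * h"] s e_S sub by (auto simp: dist_real_def)
          moreover have "\<bar>f' i s\<bar> \<le> \<bar>C\<bar>" using C[OF i, of s] s sub by force
          ultimately show "\<bar>f' i s * (b i (real (k + e) * h) - b i s)\<bar> \<le> \<bar>C\<bar> * \<epsilon>"
            unfolding abs_mult by (intro mult_mono) auto
        qed
        ultimately show "norm ((\<Sum>i\<in>I. b i (real (k + e) * h) * f' i s) - (\<Sum>i\<in>I. f' i s * b i s))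
            \<le> real (card I) * (\<bar>C\<bar> * \<epsilon>)" by simp
      qed
      moreover have "g (real (Suc k) * h) - g (real k * h)
        = (\<Sum>i\<in>I. b i (real (k + e) * h) * (f i (real (Suc k) * h) - f i (real k * h)))
        - (J (real (Suc k) * h) - J (real k * h))"
        by (simp add: g_def right_diff_distrib sum_subtractf)
      moreover have "norm (real (Suc k) * h - real k * h) = h" using h(1)
          by (simp add: algebra_simps)
      ultimately show ?thesis by simp
    qed
    have "(\<Sum>k<n. J (real (Suc k) * h) - J (real k * h)) = J t - J 0"
      using sum_lessThan_telescope[of "\<lambda>k. J (real k * h)" n] h(3) by simp
    then have "(\<Sum>i\<in>I. \<Sum>k<n. b i (real (k + e) * h) * (f i (real (Suc k) * h) - f i (real k * h)))
        - (J t - J 0)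
      = (\<Sum>k<n. (\<Sum>i\<in>I. b i (real (k + e) * h) * (f i (real (Suc k) * h) - f i (real k * h)))
        - (J (real (Suc k) * h) - J (real k * h)))"
      by (subst sum.swap) (simp add: sum_subtractf)
    also have "\<bar>\<dots>\<bar> \<le> (\<Sum>k<n. real (card I) * (\<bar>C\<bar> * \<epsilon>) * h)"
      by (rule order_trans[OF sum_abs], rule sum_mono) (use step in auto)
    also have "\<dots> = real (card I) * \<bar>C\<bar> * t * \<epsilon>" using h(3) by (simp add: mult_ac)
    also have "\<dots> < K * \<epsilon>"
    proof (rule mult_strict_right_mono[OF _ \<epsilon>])
      have "real (card I) * \<bar>C\<bar> * t \<le> real (card I) * (\<bar>C\<bar> + 1) * t"
        using t by (intro mult_right_mono mult_left_mono) auto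
      then show "real (card I) * \<bar>C\<bar> * t < K" by (simp add: K_def)
    qed
    also have "\<dots> = r" using K by (simp add: \<epsilon>_def)
    finally show ?thesis by (simp add: h_def)
  qed
  then show "\<exists>n0. \<forall>n\<ge>n0. norm ((\<Sum>i\<in>I. \<Sum>k<n. b i (real (k
      + e) * (t / n)) * (f i (real (Suc k) * (t / n)) - f i (real k * (t / n))))
       - (J t - J 0)) < r" by blast
qed

section \<open>Steady-state variances on a tree\<close>

text \<open>Rewrites a sum over a coarse grid as one over its refinement with an integrand constant
  on blocks of length \<open>r\<close>, so that two grids can be subtracted termwise.\<close>

lemma sum_blocks:
  fixes g :: "nat \<Rightarrow> real" and b :: "nat \<Rightarrow> real"
  assumes "0 < r"
  shows "(\<Sum>k<n * r. g (k div r) * (b (Suc k) - b k)) = (\<Sum>k<n. g k * (b (Suc k * r) - b (k * r)))"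
proof -
  have "(\<Sum>k<n * r. g (k div r) * (b (Suc k) - b k)) = (\<Sum>m<n. \<Sum>k\<in>{m * r..<m * r
      + r}. g (k div r) * (b (Suc k) - b k))"
    by (rule sum.nat_group[symmetric])
  also have "\<dots> = (\<Sum>m<n. g m * (\<Sum>k\<in>{m * r..<m * r + r}. b (Suc k) - b k))"
  proof (intro sum.cong refl)
    fix m
    have "k div r = m" if "k \<in> {m * r..<m * r + r}" for k
      using that by (intro div_nat_eqI) (simp_all add: mult.commute)
    then show "(\<Sum>k\<in>{m * r..<m * r + r}. g (k div r) * (b (Suc k) - b k))
        = g m * (\<Sum>k\<in>{m * r..<m * r + r}. b (Suc k) - b k)"
      unfolding sum_distrib_left by (intro sum.cong refl) simp
  qed
  also have "\<dots> = (\<Sum>k<n. g k * (b (Suc k * r) - b (k * r)))"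
    by (intro sum.cong refl, subst sum_Suc_diff') (simp_all add: add.commute)
  finally show ?thesis .
qed

lemma DERIV_reflect:
  fixes f :: "real \<Rightarrow> real"
  assumes "\<And>s. (f has_real_derivative f' s) (at s)"
  shows "((\<lambda>s. f (t - s)) has_real_derivative - f' (t - s)) (at s)"
proof -
  have "((\<lambda>s. t - s) has_real_derivative - 1) (at s)" by (auto intro!: derivative_eq_intros)
  from DERIV_chain2[OF assms this] show ?thesis by simp
qed

section \<open>The state of a single-leader system as a Wiener integral\<close>

context nontrivial_tree begin

context
  fixes u i xbar and P :: "'w measure" and W x
  assumes u: "u \<in> pverts G" and i: "i \<in> pverts G" "i \<noteq> u"
    and sys: "leader_follower_system G {u} xbar P W x"
begin

interpretation leader_follower_system G "{u}" xbar P W x by (rule sys)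

abbreviation "followers \<equiv> pverts G - {u}"

lemma finite_followers: "finite followers" using pair_finite_verts by simp

text \<open>
  Pairing the state with a solution \<open>\<Phi>\<close> of the backward equation cancels the drift. Since the state
  minus the noise is continuously differentiable along almost every path, the remaining Wiener
  integral of \<open>\<Phi>\<close> is a pathwise limit of Riemann-Stieltjes sums.
\<close>

lemma propagated_noise_limit:
  fixes \<Phi> :: "'a \<Rightarrow> real \<Rightarrow> real"
  assumes t: "0 < t" and \<Phi>u: "\<And>s. \<Phi> u s = 0"
    and \<Phi>: "\<And>j s. j \<in> followers \<Longrightarrow> (\<Phi> j has_real_derivative laplacian G (\<lambda>k. \<Phi> k s) j) (at s)"
    and C: "\<And>j s. j \<in> followers \<Longrightarrow> s \<in> {0..t} \<Longrightarrow> \<bar>laplacian G (\<lambda>k. \<Phi> k s) j\<bar> \<le> C"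
  shows "AE \<omega> in P. (\<lambda>n. \<Sum>j\<in>followers. \<Sum>k<n. \<Phi> j (real k * (t / n)) * (W j (real (Suc k) * (t /
      n)) \<omega> - W j (real k * (t / n)) \<omega>))
    \<longlonglongrightarrow> (\<Sum>j\<in>followers. \<Phi> j t * (x j t \<omega> - xbar)) - (\<Sum>j\<in>followers. \<Phi> j 0 * (x j 0 \<omega> - xbar))"
proof -
  have "AE \<omega> in P. \<forall>j\<in>followers. continuous_on {0..} (\<lambda>t. W j t \<omega>)"
    using noise finite_followers unfolding independent_wiener_processes_def wiener_process_def
    by (intro AE_finite_allI) auto
  moreover have "AE \<omega> in P. \<forall>j\<in>followers. continuous_on {0..} (\<lambda>t. x j t \<omega>)"
    using follower_continuous finite_followers by (intro AE_finite_allI) auto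
  moreover have "AE \<omega> in P. \<forall>j\<in>followers. \<forall>t\<ge>0. x j t \<omega> = x j 0 \<omega>
           + integral {0..t} (\<lambda>s. - (\<Sum>k\<in>neighbors G j. x j s \<omega> - x k s \<omega>)) + W j t \<omega>"
    using follower_dynamics finite_followers by (intro AE_finite_allI) auto
  ultimately show ?thesis using AE_space
  proof eventually_elim
    case (elim \<omega>)
    define y where "y j s = x j s \<omega> - xbar" for j s
    define z where "z j s = y j s - W j s \<omega>" for j s
    have x_u: "x u s \<omega> = xbar" if "0 \<le> s" for s using leader_state elim(4) that by simp
    have cont_x: "continuous_on {0..t} (\<lambda>s. x j s \<omega>)" if "j \<in> pverts G" for j
    proof (cases "j = u")
      case True
      have "continuous_on {0..t} (\<lambda>s. x u s \<omega>) \<longleftrightarrow> continuous_on {0..t} (\<lambda>_. xbar)"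
        using x_u by (intro continuous_on_cong) auto
      then show ?thesis using True by simp
    next
      case False
      then show ?thesis using elim(2) that by (auto intro: continuous_on_subset)
    qed
    have z': "(z j has_real_derivative - laplacian G (\<lambda>k. y k s) j) (at s within {0..t})"
      if j: "j \<in> followers" and s: "s \<in> {0..t}" for j s
    proof -
      have "continuous_on {0..t} (\<lambda>s. - (\<Sum>k\<in>N j. x j s \<omega> - x k s \<omega>))"
        using j neighbor_in_verts by (intro continuous_intros cont_x) auto
      from integral_has_real_derivative[OF this s]
      have "((\<lambda>s. x j 0 \<omega> - xbar + integral {0..s} (\<lambda>s. - (\<Sum>k\<in>N j. x j s \<omega> - x k s \<omega>)))
          has_real_derivative 0 + - (\<Sum>k\<in>N j. x j s \<omega> - x k s \<omega>)) (at s within {0..t})"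
        by (intro DERIV_add DERIV_const)
      then have "((\<lambda>s. x j 0 \<omega> - xbar + integral {0..s} (\<lambda>s. - (\<Sum>k\<in>N j. x j s \<omega> - x k s \<omega>)))
          has_real_derivative - laplacian G (\<lambda>k. y k s) j) (at s within {0..t})"
        by (simp add: laplacian_def y_def)
      moreover have "z j r = x j 0 \<omega> - xbar + integral {0..r} (\<lambda>s. - (\<Sum>k\<in>N j. x j s \<omega> - x k s \<omega>))"
        if r: "r \<in> {0..t}" for r
      proof -
        have "0 \<le> r" using r by simp
        then show ?thesis using elim(3)[rule_format, OF j, of r] unfolding z_def y_def by linarith
      qed
      ultimately show ?thesis
        unfolding has_field_derivative_def by (rule has_derivative_transform[OF s, rotated])
    qed
    \<comment> \<open>by symmetry of the Laplacian, an antiderivative of \<open>\<Sum>j. \<Phi>' j * W j\<close>\<close>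
    define J where "J s = - (\<Sum>j\<in>followers. \<Phi> j s * z j s)" for s
    have J: "(J has_real_derivative (\<Sum>j\<in>followers. laplacian G (\<lambda>k. \<Phi> k s) j * W j s \<omega>)) (at s
        within {0..t})"
      if s: "s \<in> {0..t}" for s
    proof -
      have "(J has_real_derivative - (\<Sum>j\<in>followers. laplacian G (\<lambda>k. \<Phi> k s) j * z j s +
          - laplacian G (\<lambda>k. y k s) j * \<Phi> j s))
          (at s within {0..t})"
        unfolding J_def using s
        by (intro DERIV_minus DERIV_sum DERIV_mult z' has_field_derivative_at_within[OF \<Phi>]) auto
      moreover have "(\<Sum>j\<in>followers. y j s * laplacian G (\<lambda>k. \<Phi> k s) j)
          = (\<Sum>j\<in>followers. \<Phi> j s * laplacian G (\<lambda>k. y k s) j)"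
        using laplacian_symmetric_vanishing[OF u, of "\<lambda>k. \<Phi> k s" "\<lambda>k. y k s"] \<Phi>u x_u s
            by (simp add: y_def)
      then have "- (\<Sum>j\<in>followers. laplacian G (\<lambda>k. \<Phi> k s) j * z j s +
          - laplacian G (\<lambda>k. y k s) j * \<Phi> j s)
          = (\<Sum>j\<in>followers. laplacian G (\<lambda>k. \<Phi> k s) j * W j s \<omega>)"
        by (simp add: z_def sum.distrib sum_negf sum_subtractf algebra_simps)
      ultimately show ?thesis by simp
    qed
    have W: "continuous_on {0..t} (\<lambda>s. W j s \<omega>)" if "j \<in> followers" for j
      using elim(1) that by (auto intro: continuous_on_subset)
    \<comment> \<open>Right endpoints for the noise, because summation by parts then leaves left
      endpoints for \<Phi>, as in the claim.\<close>
    have "(\<lambda>n. \<Sum>j\<in>followers. \<Sum>k<n. W j (real (k + 1) * (t / n)) \<omega> * (\<Phi> j (real (Suc k) * (t / n))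
        - \<Phi> j (real k * (t / n))))
        \<longlonglongrightarrow> J t - J 0"
      by (rule stieltjes_sums[OF t finite_followers order.refl W has_field_derivative_at_within[OF
          \<Phi>] C J])
    then have "(\<lambda>n. (\<Sum>j\<in>followers. \<Phi> j t * W j t \<omega> - \<Phi> j 0 * W j 0 \<omega>) -
        (\<Sum>j\<in>followers. \<Sum>k<n. W j (real (k + 1) * (t / n)) \<omega> * (\<Phi> j (real (Suc k) * (t / n))
            - \<Phi> j (real k * (t / n)))))
        \<longlonglongrightarrow> (\<Sum>j\<in>followers. \<Phi> j t * W j t \<omega> - \<Phi> j 0 * W j 0 \<omega>) - (J t - J 0)"
      by (intro tendsto_diff tendsto_const)
    also have "(\<Sum>j\<in>followers. \<Phi> j t * W j t \<omega> - \<Phi> j 0 * W j 0 \<omega>) - (J t - J 0)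
      = (\<Sum>j\<in>followers. \<Phi> j t * (x j t \<omega> - xbar)) - (\<Sum>j\<in>followers. \<Phi> j 0 * (x j 0 \<omega> - xbar))"
      by (simp add: J_def z_def y_def sum_subtractf sum.distrib algebra_simps)
    finally show ?case
    proof (rule Lim_transform_eventually)
      show "\<forall>\<^sub>F n in sequentially. (\<Sum>j\<in>followers. \<Phi> j t * W j t \<omega> - \<Phi> j 0 * W j 0 \<omega>) -
        (\<Sum>j\<in>followers. \<Sum>k<n. W j (real (k + 1) * (t / n)) \<omega> * (\<Phi> j (real (Suc k) * (t / n))
            - \<Phi> j (real k * (t / n))))
        = (\<Sum>j\<in>followers. \<Sum>k<n. \<Phi> j (real k * (t / n)) * (W j (real (Suc k) * (t / n)) \<omega>
            - W j (real k * (t / n)) \<omega>))"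
        using eventually_gt_at_top[of 0]
      proof eventually_elim
        case (elim n)
        \<comment> \<open>Here \<open>n > 0\<close> matters: the telescoping sum ends at
          \<open>n * (t / n)\<close>, which equals \<open>t\<close> only then, division by zero
          being 0.\<close>
        have "\<Phi> j t * W j t \<omega> - \<Phi> j 0 * W j 0 \<omega>
            = (\<Sum>k<n. \<Phi> j (real (Suc k) * (t / n)) * W j (real (Suc k) * (t / n)) \<omega>
            - \<Phi> j (real k * (t / n)) * W j (real k * (t / n)) \<omega>)" for j
          using sum_lessThan_telescope[of "\<lambda>k. \<Phi> j (real k * (t / n)) * W j (real k * (t / n)) \<omega>"
              n] elim
          by simp
        then show ?case
          by (simp add: sum_subtractf[symmetric] algebra_simps del: of_nat_Suc)
      qed
    qed
  qed
qed

text \<open>\<open>D\<close> is the pathwise limit of step-function integrals whose second moments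
  are Riemann sums for \<open>H t\<close>. Along dyadic grids these integrals are Cauchy in L2, so
  the isometry survives the limit.\<close>

lemma propagated_noise_second_moment:
  assumes t: "0 < t" and \<phi>: "dirichlet_flow u \<phi>"
    and H: "\<And>s. (H has_real_derivative (\<Sum>j\<in>followers. (\<phi> s j)\<^sup>2)) (at s)" "H 0 = 0"
  defines "D \<equiv> \<lambda>\<omega>. (\<Sum>j\<in>followers. \<phi> 0 j * (x j t \<omega> - xbar)) - (\<Sum>j\<in>followers. \<phi> t j * (x j 0 \<omega>
      - xbar))"
  shows "integrable P (\<lambda>\<omega>. (D \<omega>)\<^sup>2)" "expectation (\<lambda>\<omega>. (D \<omega>)\<^sup>2) = H t"
proof -
  \<comment> \<open>Time reversal turns the heat flow into the backward equation; the initial value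
    of \<phi> is now met at time \<open>t\<close>.\<close>
  define \<Phi> where "\<Phi> j s = \<phi> (t - s) j" for j s
  have \<Phi>u: "\<Phi> u s = 0" for s using \<phi> by (simp add: dirichlet_flow_def \<Phi>_def)
  have \<Phi>: "(\<Phi> j has_real_derivative laplacian G (\<lambda>k. \<Phi> k s) j) (at s)" if "j \<in> followers" for j s
    using DERIV_reflect[of "\<lambda>s. \<phi> s j" "\<lambda>s. - laplacian G (\<phi> s) j" t s] \<phi> that
    by (simp add: dirichlet_flow_def \<Phi>_def[abs_def])
  have cont_\<Phi>: "continuous_on S (\<Phi> j)" if "j \<in> pverts G" for j S
    using that \<Phi>u \<Phi> by (cases "j
        = u") (auto intro!: continuous_at_imp_continuous_on DERIV_isCont simp:
            continuous_on_cong[OF refl, of S "\<Phi> u" "\<lambda>_. 0"])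
  have "\<exists>C. \<forall>s\<in>{0..t}. \<bar>laplacian G (\<lambda>k. \<Phi> k s) j\<bar> \<le> C" if "j \<in> followers" for j
  proof -
    have "continuous_on {0..t} (\<lambda>s. laplacian G (\<lambda>k. \<Phi> k s) j)"
      unfolding laplacian_def using that neighbor_in_verts by (intro continuous_intros cont_\<Phi>) auto
    then have "bounded ((\<lambda>s. laplacian G (\<lambda>k. \<Phi> k s) j) ` {0..t})"
      by (intro compact_imp_bounded compact_continuous_image) auto
    then show ?thesis by (auto simp: bounded_iff)
  qed
  then obtain C' where C': "\<And>j s. j \<in> followers \<Longrightarrow> s \<in> {0..t} \<Longrightarrow> \<bar>laplacian G (\<lambda>k. \<Phi> k s) j\<bar> \<le> C' j"
      by metis
  define C where "C = (\<Sum>j\<in>followers. \<bar>C' j\<bar>)"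
  have C: "\<bar>laplacian G (\<lambda>k. \<Phi> k s) j\<bar> \<le> C" if "j \<in> followers" "s \<in> {0..t}" for j s
  proof -
    have "\<bar>C' j\<bar> \<le> C" unfolding C_def using that finite_followers by (intro member_le_sum) auto
    then show ?thesis using C'[OF that] by linarith
  qed
  have C0: "0 \<le> C" unfolding C_def by (intro sum_nonneg) auto
  have lipschitz: "\<bar>\<Phi> j r - \<Phi> j s\<bar> \<le> C * \<bar>r - s\<bar>" if "j \<in> followers" "r \<in> {0..t}" "s \<in> {0..t}"
      for j r s
    using field_differentiable_bound[of "{0..t}" "\<Phi> j" "\<lambda>s. laplacian G (\<lambda>k. \<Phi> k s) j" C r s]
      has_field_derivative_at_within[OF \<Phi>] C that by auto
  define S where "S n \<omega> = (\<Sum>j\<in>followers. \<Sum>k<n. \<Phi> j (real k * (t / real n)) *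
      (W j (real (Suc k) * (t / real n)) \<omega> - W j (real k * (t / real n)) \<omega>))" for n :: nat and \<omega>
  have W_meas: "W j s \<in> borel_measurable P" if "j \<in> followers" "0 \<le> s" for j s
    using noise that by (simp add: independent_wiener_processes_def wiener_process_def)
  have S_meas: "S n \<in> borel_measurable P" for n
    unfolding S_def using t W_meas
    by (intro borel_measurable_sum borel_measurable_times borel_measurable_const
        borel_measurable_diff) auto
  have D_meas: "D \<in> borel_measurable P"
    unfolding D_def using t state_measurable
    by (intro borel_measurable_sum borel_measurable_times borel_measurable_const
        borel_measurable_diff) auto
  have D_eq: "D \<omega> = (\<Sum>j\<in>followers. \<Phi> j t * (x j t \<omega> - xbar)) - (\<Sum>j\<in>followers. \<Phi> j 0 * (x j 0 \<omega>
      - xbar))" for \<omega>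
    by (simp add: D_def \<Phi>_def)
  have lim: "AE \<omega> in P. (\<lambda>n. S n \<omega>) \<longlonglongrightarrow> D \<omega>"
    unfolding S_def D_eq by (rule propagated_noise_limit[OF t \<Phi>u \<Phi> C])
  note moment = wiener_sum_second_moment[OF noise finite_followers]
  have S_int: "integrable P (\<lambda>\<omega>. (S (2 ^ n) \<omega>)\<^sup>2)" for n :: nat
    unfolding S_def using t by (intro moment(1)) auto
  have S_moment: "expectation (\<lambda>\<omega>. (S (2 ^ n) \<omega>)\<^sup>2)
      = (\<Sum>j\<in>followers. \<Sum>k<2 ^ n. (\<Phi> j (real k * (t / 2 ^ n)))\<^sup>2 * (t / 2 ^ n))" for n :: nat
    unfolding S_def using t by (subst moment(2)) auto
  have sub: "filterlim (\<lambda>n::nat. 2 ^ n :: nat) at_top at_top"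
    by (rule filterlim_subseq) (simp add: strict_mono_def)
  have L: "(\<lambda>n. expectation (\<lambda>\<omega>. (S (2 ^ n) \<omega>)\<^sup>2)) \<longlonglongrightarrow> H t"
  proof -
    define b where "b s = (\<Sum>j\<in>followers. (\<Phi> j s)\<^sup>2)" for s
    \<comment> \<open>Ordinary Riemann sums as a special case of \<open>stieltjes_sums\<close>: one
      integrator, the identity, with left endpoints and antiderivative
      \<open>- H (t - s)\<close>.\<close>
    have "(\<lambda>n. \<Sum>j\<in>{()}. \<Sum>k<n. b (real (k + 0) * (t / real n)) * (real (Suc k) * (t / real n)
        - real k * (t / real n)))
        \<longlonglongrightarrow> - H (t - t) - - H (t - 0)"
    proof (rule stieltjes_sums[where f' = "\<lambda>_ _. 1" and C = 1, OF t])
      show "continuous_on {0..t} b"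
        unfolding b_def using cont_\<Phi> by (intro continuous_intros) auto
      show "((\<lambda>s. - H (t - s)) has_real_derivative (\<Sum>i\<in>{()}. 1 * b s)) (at s within {0..t})" for s
        using DERIV_minus[OF DERIV_reflect[OF H(1)], of t s]
        by (simp add: b_def \<Phi>_def has_field_derivative_at_within)
    qed auto
    then have "(\<lambda>n. \<Sum>k<n. b (real k * (t / real n)) * (t / real n)) \<longlonglongrightarrow> H t"
      using H(2) by (simp add: algebra_simps add_divide_distrib)
    from filterlim_compose[OF this sub]
    have "(\<lambda>n. \<Sum>k<2 ^ n. b (real k * (t / 2 ^ n)) * (t / 2 ^ n)) \<longlonglongrightarrow> H t" by simp
    then show ?thesis
      unfolding S_moment b_def sum_distrib_right by (subst sum.swap)
  qed
  \<comment> \<open>On each fine interval the two integrands differ by at most \<open>C\<close>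
    times the coarse mesh; the fine intervals have total length \<open>t\<close> for each
    follower.\<close>
  define \<epsilon> where "\<epsilon> n = real (card followers) * t * (C * (t / 2 ^ n))\<^sup>2" for n :: nat
  have \<epsilon>: "\<epsilon> \<longlonglongrightarrow> 0"
  proof -
    have "(\<lambda>n. real (card followers) * t * (C * (t * (1 / 2) ^ n))\<^sup>2)
        \<longlonglongrightarrow> real (card followers) * t * (C * (t * 0))\<^sup>2"
      by (intro tendsto_intros LIMSEQ_power_zero) simp
    then show ?thesis by (simp add: \<epsilon>_def[abs_def] power_one_over field_simps)
  qed
  have Cauchy: "expectation (\<lambda>\<omega>. (S (2 ^ n) \<omega> - S (2 ^ m) \<omega>)\<^sup>2) \<le> \<epsilon> n" if nm: "n \<le> m" for n m :: nat
  proof -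
    define r :: nat where "r = 2 ^ (m - n)"
    have r: "0 < r" "2 ^ m = 2 ^ n * r" by (simp_all add: r_def power_add[symmetric] nm)
    define h where "h = t / 2 ^ m"
    have h: "0 < h" "t / 2 ^ n = real r * h" "2 ^ m * h = t"
      using t r(1) by (auto simp: h_def r(2)[THEN arg_cong[where f = real], simplified])
    \<comment> \<open>Coarse minus fine integrand on the fine grid: the coarse one is evaluated at
      the start of the block containing \<open>k\<close>.\<close>
    define f where "f j k = \<Phi> j (real (k div r) * (real r * h)) - \<Phi> j (real k * h)" for j k
    have "S (2 ^ n) \<omega> - S (2 ^ m) \<omega> = (\<Sum>j\<in>followers. \<Sum>k<2 ^ m. f j k * (W j (real (Suc k) * h) \<omega>
        - W j (real k * h) \<omega>))" for \<omega>
    proof -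
      have "(\<Sum>k<2 ^ n. \<Phi> j (real k * (real r * h)) * (W j (real (Suc k) * (real r * h)) \<omega>
          - W j (real k * (real r * h)) \<omega>))
        = (\<Sum>k<2 ^ m. \<Phi> j (real (k div r) * (real r * h)) * (W j (real (Suc k) * h) \<omega>
            - W j (real k * h) \<omega>))" for j
        using sum_blocks[OF r(1), of "\<lambda>k. \<Phi> j (real k * (real r * h))" "\<lambda>k. W j (real k * h) \<omega>" "2
            ^ n"]
        unfolding r(2) by (simp only: of_nat_mult mult.assoc)
      moreover have "S (2 ^ n) \<omega>
          = (\<Sum>j\<in>followers. \<Sum>k<2 ^ n. \<Phi> j (real k * (real r * h)) * (W j (real (Suc k) * (real r *
              h)) \<omega> - W j (real k * (real r * h)) \<omega>))"
        by (simp add: S_def h(2) del: of_nat_Suc)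
      moreover have "S (2 ^ m) \<omega>
          = (\<Sum>j\<in>followers. \<Sum>k<2 ^ m. \<Phi> j (real k * h) * (W j (real (Suc k) * h) \<omega>
              - W j (real k * h) \<omega>))"
        by (simp add: S_def h_def del: of_nat_Suc)
      ultimately show ?thesis
        by (simp add: f_def sum_subtractf[symmetric] left_diff_distrib del: of_nat_Suc)
    qed
    then have "expectation (\<lambda>\<omega>. (S (2 ^ n) \<omega> - S (2 ^ m) \<omega>)\<^sup>2)
        = (\<Sum>j\<in>followers. \<Sum>k<2 ^ m. (f j k)\<^sup>2 * h)"
      using moment(2)[OF h(1), of f "2 ^ m"] by simp
    also have "\<dots> \<le> (\<Sum>j\<in>followers. \<Sum>k<2 ^ m :: nat. (C * (t / 2 ^ n))\<^sup>2 * h)"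
    proof (intro sum_mono mult_right_mono)
      fix j k assume j: "j \<in> followers" and k: "k \<in> {..<2 ^ m :: nat}"
      have "real k * h \<le> real (2 ^ m) * h" using k h(1) by (intro mult_right_mono) auto
      then have le_t: "real k * h \<le> t" using h(3) by simp
      define p where "p = real (k div r) * (real r * h)"
      have p: "p = real (k div r * r) * h" by (simp add: p_def)
      have "k div r * r \<le> k" "k \<le> k div r * r + r"
        using dividend_less_div_times[OF r(1), of k] by (simp_all add: add.commute)
      then have "real (k div r * r) \<le> real k" "real k \<le> real (k div r * r) + real r"
        unfolding of_nat_add[symmetric] of_nat_le_iff .
      then have near: "p \<le> real k * h" "real k * h \<le> p + real r * h"
        using h(1) unfolding p distrib_right[symmetric]
            by (auto intro!: mult_right_mono simp del: of_nat_mult)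
      have "0 \<le> p" using h(1) by (simp add: p_def)
      then have "\<bar>f j k\<bar> \<le> C * \<bar>p - real k * h\<bar>"
        unfolding f_def p_def[symmetric] using j near(1) le_t h(1) by (intro lipschitz) auto
      also have "\<dots> \<le> C * (t / 2 ^ n)"
        using near C0 unfolding h(2) by (intro mult_left_mono) auto
      finally show "(f j k)\<^sup>2 \<le> (C * (t / 2 ^ n))\<^sup>2"
        by (intro power2_le_iff_abs_le[THEN iffD2]) (use C0 t in auto)
    qed (use h(1) in auto)
    also have "\<dots> = real (card followers) * (C * (t / 2 ^ n))\<^sup>2 * (2 ^ m * h)" by simp
    also have "\<dots> = \<epsilon> n" unfolding h(3) by (simp add: \<epsilon>_def)
    finally show ?thesis .
  qed
  have lim': "AE \<omega> in P. (\<lambda>n. S (2 ^ n) \<omega>) \<longlonglongrightarrow> D \<omega>"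
    using lim by eventually_elim (rule filterlim_compose[OF _ sub])
  note * = L2_Cauchy_limit[of "\<lambda>n. S (2 ^ n)", OF S_meas D_meas S_int lim' Cauchy \<epsilon> L]
  show "integrable P (\<lambda>\<omega>. (D \<omega>)\<^sup>2)" "expectation (\<lambda>\<omega>. (D \<omega>)\<^sup>2) = H t" using * by auto
qed

text \<open>Pairing with the kernel that starts at the unit vector of \<open>i\<close> isolates the
  deviation of \<open>i\<close>. It splits into propagated noise, with second moment
  \<open>H t\<close>, and propagated initial states, which vanish in L2 as the kernel
  decays.\<close>

lemma variance_tendsto:
  "((\<lambda>t. expectation (\<lambda>\<omega>. (x i t \<omega> - xbar)\<^sup>2)) \<longlongrightarrow> real (d u i) / 2) at_top"
proof -
  obtain \<phi> H where \<phi>: "dirichlet_flow u \<phi>" and \<phi>0: "\<And>j. j \<in> pverts G \<Longrightarrow> \<phi> 0 j = (if j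
      = i then 1 else 0)"
    and H: "\<And>s. (H has_real_derivative (\<Sum>j\<in>followers. (\<phi> s j)\<^sup>2)) (at s)" "H 0 = 0"
    "(H \<longlongrightarrow> real (d u i) / 2) at_top"
    and \<phi>_lim: "\<And>j. j \<in> pverts G \<Longrightarrow> ((\<lambda>s. \<phi> s j) \<longlongrightarrow> 0) at_top"
    by (fact heat_kernel[OF u i])
  \<comment> \<open>The initial states may depend on the noise, so the mixed term is controlled
      by Cauchy-Schwarz only.\<close>
  define y0 where "y0 j \<omega> = x j 0 \<omega> - xbar" for j \<omega>
  define Y where "Y t \<omega> = (\<Sum>j\<in>followers. \<phi> t j * y0 j \<omega>)" for t \<omega>
  \<comment> \<open>The value 0 for \<open>t \<le> 0\<close> makes \<open>D t\<close> measurable at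
    every index, as \<open>second_moment_perturb\<close> demands; the states are known to be
    measurable for nonnegative times only.\<close>
  define D where "D t \<omega> = (if 0 < t then (\<Sum>j\<in>followers. \<phi> 0 j * (x j t \<omega> - xbar)) - Y t \<omega> else 0)"
      for t \<omega>
  have y0_meas [measurable]: "y0 j \<in> borel_measurable P" if "j \<in> followers" for j
    unfolding y0_def using state_measurable that by simp
  have y0_int: "integrable P (\<lambda>\<omega>. (y0 j \<omega>)\<^sup>2)" if "j \<in> followers" for j
    using integrable_square_add[of "x j 0" P "\<lambda>_. - xbar"] state_measurable initial_state that
    by (simp add: y0_def)
  have Y_meas: "Y t \<in> borel_measurable P" for t
    unfolding Y_def by (intro borel_measurable_sum borel_measurable_times borel_measurable_const
        y0_meas)
  have D_meas: "D t \<in> borel_measurable P" for t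
  proof (cases "0 < t")
    case True
    have "(\<lambda>\<omega>. (\<Sum>j\<in>followers. \<phi> 0 j * (x j t \<omega> - xbar)) - Y t \<omega>) \<in> borel_measurable P"
      using True state_measurable
      by (intro borel_measurable_sum borel_measurable_times borel_measurable_const
          borel_measurable_diff Y_meas) auto
    then show ?thesis using True by (simp add: D_def[abs_def])
  qed (simp add: D_def[abs_def])
  have D: "integrable P (\<lambda>\<omega>. (D t \<omega>)\<^sup>2)" "expectation (\<lambda>\<omega>. (D t \<omega>)\<^sup>2) = H t" if "0 < t" for t
    using propagated_noise_second_moment[OF that \<phi> H(1,2)] that
    by (simp_all add: D_def Y_def y0_def)
  have Y_le: "(Y t \<omega>)\<^sup>2 \<le> (\<Sum>j\<in>followers. (\<phi> t j)\<^sup>2) * (\<Sum>j\<in>followers. (y0 j \<omega>)\<^sup>2)" for t \<omega>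
    unfolding Y_def by (rule Cauchy_Schwarz_ineq_sum)
  have sum_int: "integrable P (\<lambda>\<omega>. (\<Sum>j\<in>followers. (\<phi> t j)\<^sup>2) * (\<Sum>j\<in>followers. (y0 j \<omega>)\<^sup>2))" for t
    using y0_int by (intro integrable_mult_right Bochner_Integration.integrable_sum) auto
  have Y_int: "integrable P (\<lambda>\<omega>. (Y t \<omega>)\<^sup>2)" for t
  proof (rule Bochner_Integration.integrable_bound[OF sum_int[of t]])
    show "(\<lambda>\<omega>. (Y t \<omega>)\<^sup>2) \<in> borel_measurable P" using Y_meas by simp
    show "AE \<omega> in P. norm ((Y t \<omega>)\<^sup>2)
        \<le> norm ((\<Sum>j\<in>followers. (\<phi> t j)\<^sup>2) * (\<Sum>j\<in>followers. (y0 j \<omega>)\<^sup>2))"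
      using Y_le by (intro always_eventually allI) (simp add: abs_mult sum_nonneg)
  qed
  have "((\<lambda>t. expectation (\<lambda>\<omega>. (Y t \<omega>)\<^sup>2)) \<longlongrightarrow> 0) at_top"
  proof (rule tendsto_sandwich[OF _ _ tendsto_const])
    show "\<forall>\<^sub>F t in at_top. 0 \<le> expectation (\<lambda>\<omega>. (Y t \<omega>)\<^sup>2)"
      by (intro always_eventually allI integral_nonneg_AE) auto
    show "\<forall>\<^sub>F t in at_top. expectation (\<lambda>\<omega>. (Y t \<omega>)\<^sup>2)
        \<le> (\<Sum>j\<in>followers. (\<phi> t j)\<^sup>2) * expectation (\<lambda>\<omega>. \<Sum>j\<in>followers. (y0 j \<omega>)\<^sup>2)"
      using integral_mono[OF Y_int sum_int Y_le] by (intro always_eventually allI) simp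
    have "((\<lambda>t. (\<Sum>j\<in>followers. (\<phi> t j)\<^sup>2) * expectation (\<lambda>\<omega>. \<Sum>j\<in>followers. (y0 j \<omega>)\<^sup>2)) \<longlongrightarrow>
        (\<Sum>j\<in>followers. 0\<^sup>2) * expectation (\<lambda>\<omega>. \<Sum>j\<in>followers. (y0 j \<omega>)\<^sup>2)) at_top"
      using \<phi>_lim by (intro tendsto_intros) auto
    then show "((\<lambda>t. (\<Sum>j\<in>followers. (\<phi> t j)\<^sup>2) * expectation (\<lambda>\<omega>. \<Sum>j\<in>followers. (y0 j \<omega>)\<^sup>2)) \<longlongrightarrow> 0)
        at_top" by simp
  qed
  moreover have "((\<lambda>t. expectation (\<lambda>\<omega>. (D t \<omega>)\<^sup>2)) \<longlongrightarrow> real (d u i) / 2) at_top"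
  proof (rule Lim_transform_eventually[OF H(3)])
    show "\<forall>\<^sub>F t in at_top. H t = expectation (\<lambda>\<omega>. (D t \<omega>)\<^sup>2)"
      using eventually_gt_at_top[of 0] by eventually_elim (simp add: D(2))
  qed
  moreover have "\<forall>\<^sub>F t in at_top. integrable P (\<lambda>\<omega>. (D t \<omega>)\<^sup>2)"
    using eventually_gt_at_top[of 0] by eventually_elim (rule D(1))
  ultimately have "((\<lambda>t. expectation (\<lambda>\<omega>. (D t \<omega> + Y t \<omega>)\<^sup>2)) \<longlongrightarrow> real (d u i) / 2) at_top"
    using Y_int by (intro second_moment_perturb D_meas Y_meas) auto
  moreover have "\<forall>\<^sub>F t in at_top. expectation (\<lambda>\<omega>. (D t \<omega> + Y t \<omega>)\<^sup>2) = expectation (\<lambda>\<omega>. (x i t \<omega>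
      - xbar)\<^sup>2)"
    using eventually_gt_at_top[of 0]
  proof eventually_elim
    case (elim t)
    have "(\<Sum>j\<in>followers. \<phi> 0 j * (x j t \<omega> - xbar)) = (\<Sum>j\<in>followers. if j = i then x i t \<omega>
        - xbar else 0)" for \<omega>
      using \<phi>0 by (intro sum.cong) auto
    then have "D t \<omega> + Y t \<omega> = x i t \<omega> - xbar" for \<omega>
      using elim i finite_followers by (simp add: D_def)
    then show ?case by simp
  qed
  ultimately show ?thesis by (rule Lim_transform_eventually)
qed

lemma steady_state_variance_eq: "steady_state_variance xbar P x i = real (d u i) / 2"
  unfolding steady_state_variance_def
  by (rule tendsto_Lim[OF trivial_limit_at_top_linorder variance_tendsto])

end

lemma max_steady_state_variance_eq:
  assumes u: "u \<in> pverts G" and sys: "leader_follower_system G {u} xbar P W x"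
  shows "max_steady_state_variance G {u} xbar P x = real (ecc u) / 2"
proof -
  let ?F = "pverts G - {u}"
  obtain r where r: "r \<in> ?F" using ex_other[of u] by (metis Diff_iff singletonD)
  have followers: "finite ?F" using pair_finite_verts by simp
  have "max_steady_state_variance G {u} xbar P x = (MAX i\<in>?F. real (d u i) / 2)"
    unfolding max_steady_state_variance_def
    using steady_state_variance_eq[OF u _ _ sys] by (intro arg_cong[where f = Max] image_cong) auto
  also have "\<dots> = real (ecc u) / 2"
  proof (rule Max_eqI)
    show "finite ((\<lambda>i. real (d u i) / 2) ` ?F)" using followers by simp
    show "y \<le> real (ecc u) / 2" if "y \<in> (\<lambda>i. real (d u i) / 2) ` ?F" for y
      using that hops_le_ecc by auto
    have "ecc u \<in> d u ` pverts G" unfolding ecc_def using u pair_finite_verts by (intro Max_in) auto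
    then obtain j where j: "j \<in> pverts G" "d u j = ecc u" by auto
    \<comment> \<open>A second vertex makes the eccentricity positive, so the farthest vertex is a
      follower and the maximum over followers attains it.\<close>
    have "d u r \<noteq> 0" using hops_eq_0D[OF u, of r] r by blast
    then have "0 < ecc u" using hops_le_ecc[of r u] r by simp
    then have "j \<in> ?F" using j by auto
    then show "real (ecc u) / 2 \<in> (\<lambda>i. real (d u i) / 2) ` ?F" using j by force
  qed
  finally show ?thesis .
qed

end

theorem theorem5:
  fixes G :: "'a pair_pre_digraph"
    and xbar :: real
    and P :: "'a set \<Rightarrow> 'w measure"
    and W x :: "'a set \<Rightarrow> 'a \<Rightarrow> real \<Rightarrow> 'w \<Rightarrow> real"
  assumes "pair_graph G"
    and "Digraph_Component.connected (with_proj G)"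
    and "undirected_acyclic G"
    and "card (pverts G) \<ge> 2"
    and "\<And>U. U \<subseteq> pverts G \<Longrightarrow> card U = 1 \<Longrightarrow>
           leader_follower_system G U xbar (P U) (W U) (x U)"
  shows "self_stabilizing_leader_selection G
           (optimal_leader G (\<lambda>U. max_steady_state_variance G U xbar (P U) (x U)))
           (ls_mv_run G)"
proof -
  interpret pair_graph G by fact
  interpret nontrivial_tree G by unfold_locales fact+
  have M: "max_steady_state_variance G {v} xbar (P {v}) (x {v}) = real (ecc v) / 2"
      if "v \<in> pverts G" for v
    using that assms(5)[of "{v}"] by (intro max_steady_state_variance_eq) simp_all
  show ?thesis
    by (rule self_stabilizing) (auto simp: optimal_leader_def is_arg_min_def M)
qed

end
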